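(* (1) The centre of $\mathcal A_\infty$ is $\mathbb C$ (the scalar multiples of the identity). (2) $C(K)$ is a maximal abelian subalgebra of $\mathcal A_\infty$.
   Context: Indices $j\in\{1,2,3\}$ are taken mod $3$. $M_3(\mathbb C)$ has matrix units $e_{ij}$, and $\mathbb C^3$ is identified with its diagonal subalgebra. $\mathrm{UHF}(3^\infty)$ is the $C^*$-inductive limit of $M_3(\mathbb C)^{\otimes n}$ under $x\mapsto x\otimes I_3$; each $M_3(\mathbb C)^{\otimes n}$ is regarded as a unital subalgebra of it. For $n\ge0$ put $\alpha^n_j=e_{jj}\otimes e_{22}^{\otimes n}\in M_3(\mathbb C)^{\otimes(n+1)}$, and for $k\ge1$ put $\beta^k_j=(e_{jj}\otimes e_{11}+e_{j+2,j+2}\otimes e_{33})\otimes e_{22}^{\otimes(k-1)}\in M_3(\mathbb C)^{\otimes(k+1)}$. The finite-dimensional $*$-algebra $\mathcal A_n\subset M_3(\mathbb C)^{\otimes(n+1)}$ is the linear span of the $\alpha^n_j$ and of the $x\otimes\beta^k_j$ with $j=1,2,3$, $k=1,\dots,n$, $x\in M_3(\mathbb C)^{\otimes(n-k)}$. $\mathcal A_\infty$ is the $C^*$-subalgebra of $\mathrm{UHF}(3^\infty)$ of all norm limits $\lim_n a_n$ with $a_n\in\mathcal A_n$. The embedding of $C(K)$ in $\mathcal A_\infty$: let $v_1,v_2,v_3$ be the vertices of an equilateral triangle in $\mathbb R^2$ and let $w_j$ be the similitude of ratio $1/2$ (affine map) with $w_j(v_2)=v_j$, $w_j(v_3)=\tfrac12(v_j+v_{j+1})$,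 $w_j(v_1)=\tfrac12(v_j+v_{j-1})$. The Sierpinski gasket $K$ is the unique nonempty compact set with $K=\bigcup_j w_j(K)$. Let $\Sigma_\infty=\{1,2,3\}^{\mathbb N}$ (product topology) and $P:\Sigma_\infty\to K$ the continuous surjection sending $\sigma$ to the unique point of $\bigcap_n w_{\sigma_1}\circ\cdots\circ w_{\sigma_n}(K)$. $C(K)$ is embedded in $C(\Sigma_\infty)$ by $f\mapsto f\circ P$, and $C(\Sigma_\infty)=(\mathbb C^3)^{\otimes\infty}$ is embedded in $\mathrm{UHF}(3^\infty)$ as the closure of the union of the diagonal subalgebras of the $M_3(\mathbb C)^{\otimes n}$ (the indicator function of the cylinder of words beginning with $\sigma_1\cdots\sigma_n$ corresponds to $e_{\sigma_1\sigma_1}\otimes\cdots\otimes e_{\sigma_n\sigma_n}$). The image of $C(K)$ is contained in $\mathcal A_\infty$. *)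

theory Defs
  imports "HOL-Analysis.Analysis" "Jordan_Normal_Form.Schur_Decomposition"
begin

section \<open>Unital complex C*-algebras\<close>

text \<open>The complex scalar multiplication extends the real one of the superclass.\<close>

class cstar_algebra = real_normed_algebra_1 + banach +
  fixes scaleC :: "complex \<Rightarrow> 'a \<Rightarrow> 'a"  (infixr "*\<^sub>C" 75)
    and star :: "'a \<Rightarrow> 'a"
  assumes scaleC_add_right: "c *\<^sub>C (x + y) = c *\<^sub>C x + c *\<^sub>C y"
    and scaleC_add_left: "(c + d) *\<^sub>C x = c *\<^sub>C x + d *\<^sub>C x"
    and scaleC_scaleC: "c *\<^sub>C d *\<^sub>C x = (c * d) *\<^sub>C x"
    and scaleC_of_real: "complex_of_real r *\<^sub>C x = r *\<^sub>R x"
    and mult_scaleC_left: "(c *\<^sub>C x) * y = c *\<^sub>C (x * y)"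
    and mult_scaleC_right: "x * (c *\<^sub>C y) = c *\<^sub>C (x * y)"
    and norm_scaleC: "norm (c *\<^sub>C x) = cmod c * norm x"
    and star_star: "star (star x) = x"
    and star_add: "star (x + y) = star x + star y"
    and star_scaleC: "star (c *\<^sub>C x) = cnj c *\<^sub>C star x"
    and star_mult: "star (x * y) = star y * star x"
    and norm_star_mult: "norm (star x * x) = (norm x)\<^sup>2"

interpretation complex_vector: vector_space "scaleC :: complex \<Rightarrow> 'a \<Rightarrow> 'a::cstar_algebra"
proof
  fix c d :: complex and x y :: 'a
  show "c *\<^sub>C (x + y) = c *\<^sub>C x + c *\<^sub>C y" by (rule scaleC_add_right)
  show "(c + d) *\<^sub>C x = c *\<^sub>C x + d *\<^sub>C x" by (rule scaleC_add_left)
  show "c *\<^sub>C d *\<^sub>C x = (c * d) *\<^sub>C x" by (rule scaleC_scaleC)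
  show "1 *\<^sub>C x = x" using scaleC_of_real[of 1 x] by simp
qed

definition cstar_subalgebra :: "'a::cstar_algebra set \<Rightarrow> bool" where
  "cstar_subalgebra B \<longleftrightarrow>
     complex_vector.subspace B \<and> (\<forall>x\<in>B. \<forall>y\<in>B. x * y \<in> B) \<and> (\<forall>x\<in>B. star x \<in> B) \<and> closed B"

definition commutative_set :: "'a::times set \<Rightarrow> bool" where
  "commutative_set B \<longleftrightarrow> (\<forall>x\<in>B. \<forall>y\<in>B. x * y = y * x)"

definition centre_of :: "'a::times set \<Rightarrow> 'a set" where
  "centre_of A = {z \<in> A. \<forall>a\<in>A. z * a = a * z}"

text \<open>As usual for C*-algebras, subalgebras are C*-subalgebras.\<close>

definition maximal_abelian_subalgebra :: "'a::cstar_algebra set \<Rightarrow> 'a set \<Rightarrow> bool" where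
  "maximal_abelian_subalgebra B A \<longleftrightarrow>
     cstar_subalgebra B \<and> commutative_set B \<and> B \<subseteq> A \<and>
     (\<forall>C. cstar_subalgebra C \<and> commutative_set C \<and> B \<subseteq> C \<and> C \<subseteq> A \<longrightarrow> C = B)"

section \<open>Tensor powers of the three by three matrices and their inductive limit\<close>

text \<open>
  The n-th tensor power of the algebra of three by three matrices is
  \<open>carrier_mat (3 ^ n) (3 ^ n)\<close>, with the Kronecker product as tensor product.
  The indices 1, 2, 3 modulo 3 are the elements of the type \<open>3\<close>, in which
  \<open>3 = 0\<close> and arithmetic is modulo 3; the index \<open>j\<close> belongs to the matrix
  row (counted from 0) \<open>r < 3\<close> with \<open>of_nat (Suc r) = j\<close>.
\<close>

definition kron :: "complex mat \<Rightarrow> complex mat \<Rightarrow> complex mat"  (infixl "\<otimes>\<^sub>K" 72) where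
  "A \<otimes>\<^sub>K B = Matrix.mat (dim_row A * dim_row B) (dim_col A * dim_col B)
     (\<lambda>(r, c). A $$ (r div dim_row B, c div dim_col B) * B $$ (r mod dim_row B, c mod dim_col B))"

definition kron_list :: "complex mat list \<Rightarrow> complex mat" where
  "kron_list As = foldr (\<otimes>\<^sub>K) As (1\<^sub>m 1)"

definition munit :: "3 \<Rightarrow> 3 \<Rightarrow> complex mat" where
  "munit i j = Matrix.mat 3 3 (\<lambda>(r, c). if of_nat (Suc r) = i \<and> of_nat (Suc c) = j then 1 else 0)"

text \<open>
  The C*-inductive limit of the tensor powers under \<open>x \<mapsto> x \<otimes> I\<close> is, up to
  isomorphism, the unital C*-algebra containing compatible copies of them with dense
  union; \<open>\<iota> n\<close> is the inclusion of the n-th power. It is automatically isometric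
  for the operator norm, being an injective *-homomorphism between C*-algebras.
\<close>

locale uhf_3_infinity =
  fixes \<iota> :: "nat \<Rightarrow> complex mat \<Rightarrow> 'u::cstar_algebra"
  assumes incl_add: "A \<in> carrier_mat (3 ^ n) (3 ^ n) \<Longrightarrow> B \<in> carrier_mat (3 ^ n) (3 ^ n) \<Longrightarrow>
      \<iota> n (A + B) = \<iota> n A + \<iota> n B"
    and incl_smult: "A \<in> carrier_mat (3 ^ n) (3 ^ n) \<Longrightarrow> \<iota> n (c \<cdot>\<^sub>m A) = c *\<^sub>C \<iota> n A"
    and incl_mult: "A \<in> carrier_mat (3 ^ n) (3 ^ n) \<Longrightarrow> B \<in> carrier_mat (3 ^ n) (3 ^ n) \<Longrightarrow>
      \<iota> n (A * B) = \<iota> n A * \<iota> n B"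
    and incl_adjoint: "A \<in> carrier_mat (3 ^ n) (3 ^ n) \<Longrightarrow> \<iota> n (mat_adjoint A) = star (\<iota> n A)"
    and incl_one: "\<iota> n (1\<^sub>m (3 ^ n)) = 1"
    and incl_inj: "inj_on (\<iota> n) (carrier_mat (3 ^ n) (3 ^ n))"
    and incl_compat: "A \<in> carrier_mat (3 ^ n) (3 ^ n) \<Longrightarrow> \<iota> (Suc n) (A \<otimes>\<^sub>K 1\<^sub>m 3) = \<iota> n A"
    and incl_dense: "closure (\<Union>n. \<iota> n ` carrier_mat (3 ^ n) (3 ^ n)) = UNIV"

definition alpha :: "nat \<Rightarrow> 3 \<Rightarrow> complex mat" where
  "alpha n j = munit j j \<otimes>\<^sub>K kron_list (replicate n (munit 2 2))"

definition beta :: "nat \<Rightarrow> 3 \<Rightarrow> complex mat" where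
  "beta k j = (munit j j \<otimes>\<^sub>K munit 1 1 + munit (j + 2) (j + 2) \<otimes>\<^sub>K munit 3 3)
     \<otimes>\<^sub>K kron_list (replicate (k - 1) (munit 2 2))"

definition A_fin :: "(nat \<Rightarrow> complex mat \<Rightarrow> 'u::cstar_algebra) \<Rightarrow> nat \<Rightarrow> 'u set" where
  "A_fin \<iota> n = complex_vector.span
     ({\<iota> (Suc n) (alpha n j) | j. True} \<union>
      {\<iota> (Suc n) (x \<otimes>\<^sub>K beta k j) | j k x.
         k \<in> {1..n} \<and> x \<in> carrier_mat (3 ^ (n - k)) (3 ^ (n - k))})"

definition A_inf :: "(nat \<Rightarrow> complex mat \<Rightarrow> 'u::cstar_algebra) \<Rightarrow> 'u set" where
  "A_inf \<iota> = {a. \<exists>s. (\<forall>n. s n \<in> A_fin \<iota> n) \<and> s \<longlonglongrightarrow> a}"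

section \<open>The Sierpinski gasket and its continuous functions\<close>

definition equilateral_triangle :: "(3 \<Rightarrow> real^2) \<Rightarrow> bool" where
  "equilateral_triangle v \<longleftrightarrow>
     v 1 \<noteq> v 2 \<and> dist (v 1) (v 2) = dist (v 2) (v 3) \<and> dist (v 2) (v 3) = dist (v 3) (v 1)"

definition gasket_maps :: "(3 \<Rightarrow> real^2) \<Rightarrow> (3 \<Rightarrow> real^2 \<Rightarrow> real^2) \<Rightarrow> bool" where
  "gasket_maps v w \<longleftrightarrow> (\<forall>j.
     linear (\<lambda>x. w j x - w j 0) \<and>
     (\<forall>x y. dist (w j x) (w j y) = dist x y / 2) \<and>
     w j (v 2) = v j \<and>
     w j (v 3) = midpoint (v j) (v (j + 1)) \<and>
     w j (v 1) = midpoint (v j) (v (j - 1)))"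

definition is_gasket :: "(3 \<Rightarrow> real^2 \<Rightarrow> real^2) \<Rightarrow> (real^2) set \<Rightarrow> bool" where
  "is_gasket w K \<longleftrightarrow> compact K \<and> K \<noteq> {} \<and> K = (\<Union>j. w j ` K)"

definition word_map :: "(3 \<Rightarrow> real^2 \<Rightarrow> real^2) \<Rightarrow> 3 list \<Rightarrow> real^2 \<Rightarrow> real^2" where
  "word_map w \<sigma> = foldr (\<lambda>j g. w j \<circ> g) \<sigma> id"

text \<open>Infinite words are sequences; the first letter of \<open>\<sigma>\<close> is \<open>\<sigma> 0\<close>.\<close>

definition coding_map :: "(3 \<Rightarrow> real^2 \<Rightarrow> real^2) \<Rightarrow> (real^2) set \<Rightarrow> (nat \<Rightarrow> 3) \<Rightarrow> real^2" where
  "coding_map w K \<sigma> = (THE x. x \<in> (\<Inter>n. word_map w (map \<sigma> [0..<n]) ` K))"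

definition extend_word :: "3 list \<Rightarrow> nat \<Rightarrow> 3" where
  "extend_word \<sigma> = (\<lambda>i. if i < length \<sigma> then \<sigma> ! i else 1)"

text \<open>
  The embedding of the continuous functions on the space of infinite words: \<open>g\<close> is the
  uniform limit of the functions that are constant, equal to \<open>g (extend_word \<sigma>)\<close>, on
  the cylinder of each word \<open>\<sigma>\<close> of length n, and the indicator function of that
  cylinder corresponds to the tensor product of the diagonal matrix units given by the
  letters of \<open>\<sigma>\<close>. If \<open>g\<close> only depends on the first N letters, the terms with
  \<open>n \<ge> N\<close> are all equal, and the limit does not depend on how words are extended.
\<close>

definition diag_embed ::
  "(nat \<Rightarrow> complex mat \<Rightarrow> 'u::cstar_algebra) \<Rightarrow> ((nat \<Rightarrow> 3) \<Rightarrow> complex) \<Rightarrow> 'u" where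
  "diag_embed \<iota> g = lim (\<lambda>n. \<Sum>\<sigma> | length \<sigma> = n.
     g (extend_word \<sigma>) *\<^sub>C \<iota> n (kron_list (map (\<lambda>j. munit j j) \<sigma>)))"

definition C_gasket ::
  "(nat \<Rightarrow> complex mat \<Rightarrow> 'u::cstar_algebra) \<Rightarrow> (3 \<Rightarrow> real^2 \<Rightarrow> real^2) \<Rightarrow> (real^2) set \<Rightarrow> 'u set"
  where
  "C_gasket \<iota> w K = {diag_embed \<iota> (f \<circ> coding_map w K) | f. continuous_on K f}"

end

theory Submission
  imports Defs
begin

text \<open>
  Pairs of words \<open>u j 1 2\<^sup>\<infinity>\<close> and \<open>u (j + 2) 3 2\<^sup>\<infinity>\<close> are exactly the distinct infinite words with
  the same image in the gasket, so \<open>C(K)\<close> consists of the diagonal elements whose coefficient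
  functions agree on all such pairs. By the shape of the \<open>\<beta>\<^sup>k\<^sub>j\<close> every diagonal element of
  \<open>\<A>\<^sub>\<infinity>\<close> has this property. It remains to see that an element \<open>a\<close> of \<open>\<A>\<^sub>\<infinity>\<close> commuting with
  \<open>C(K)\<close> is diagonal. Let \<open>g\<close> in \<open>C(K)\<close> vanish at the three outer vertices and be \<open>1\<close> on a
  cylinder. Then \<open>c \<otimes> g\<close> lies in \<open>C(K)\<close> for every diagonal \<open>c\<close> of level \<open>N\<close>; if \<open>b\<close> of level
  \<open>N\<close> is close to \<open>a\<close>, then \<open>[b, c] \<otimes> g\<close> is small, hence so is \<open>[b, c]\<close>, and averaging over
  diagonal unitaries \<open>c\<close> shows that \<open>b\<close> is close to its diagonal part. Similarly \<open>T \<otimes> g\<close> lies in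
  \<open>\<A>\<^sub>\<infinity>\<close> for every matrix \<open>T\<close> of level \<open>N\<close>, so a central element almost commutes with all matrix
  units and is a scalar.
\<close>

section \<open>C*-algebras\<close>

text \<open>The limit algebra is known only through the C*-axioms and its matrix units, so every
  norm estimate is drawn from the C*-identity. The delicate step is the passage from
  \<open>[b, c] \<otimes> g\<close> to \<open>[b, c]\<close>: the projection e of a cylinder on
  which g is 1 turns the first into \<open>[b, c] \<otimes> e\<close>, and this has the norm of
  \<open>[b, c]\<close>, since the projections of all cylinders of one length are conjugate by
  matrix units.

  The vanishing of g at the outer vertices has two reasons. In A_n only the \<beta> are tensored
  with matrices, never the \<alpha>, which sit at the outer vertices; and a copy of g on one cell of
  level N, extended by 0, is continuous on K only if g is 0 where the cell meets its neighbours.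

  The letter 2 is special because w_j(v_2) = v_j: the word 2 2 2 ... codes v_2, and every vertex of
  a cell has a code ending in 2s. This is the role of the powers of e_22 in the generators.\<close>

lemma star_zero [simp]: "star (0::'a::cstar_algebra) = 0"
  using star_scaleC[of 0 "0::'a"] by simp

lemma star_sum: "star (\<Sum>i\<in>I. f i) = (\<Sum>i\<in>I. star (f i :: 'a::cstar_algebra))"
  by (induction I rule: infinite_finite_induct) (simp_all add: star_add)

lemma star_one [simp]: "star (1::'a::cstar_algebra) = 1"
  by (metis mult.right_neutral star_mult star_star)

lemma norm_star [simp]: "norm (star x) = norm (x::'a::cstar_algebra)"
proof -
  have *: "norm y \<le> norm (star y)" for y :: 'a
  proof (cases "y = 0")
    case False
    have "norm y * norm y \<le> norm (star y) * norm y"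
      using norm_star_mult[of y] norm_mult_ineq[of "star y" y] by (simp add: power2_eq_square)
    then show ?thesis using False by simp
  qed simp
  show ?thesis using *[of x] *[of "star x"] by (simp add: star_star)
qed

lemma bounded_linear_star: "bounded_linear (star :: 'a::cstar_algebra \<Rightarrow> 'a)"
  by (rule bounded_linear_intro[where K = 1])
    (simp_all add: star_add star_scaleC flip: scaleC_of_real)

lemma bounded_linear_scaleC: "bounded_linear ((*\<^sub>C) c :: 'a::cstar_algebra \<Rightarrow> 'a)"
proof (rule bounded_linear_intro[where K = "cmod c"])
  show "c *\<^sub>C (r *\<^sub>R x) = r *\<^sub>R (c *\<^sub>C x)" for r and x :: 'a
    by (simp only: scaleC_scaleC mult.commute flip: scaleC_of_real)
qed (simp_all add: scaleC_add_right norm_scaleC)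

lemmas tendsto_star = bounded_linear.tendsto[OF bounded_linear_star]
lemmas tendsto_scaleC = bounded_linear.tendsto[OF bounded_linear_scaleC]

section \<open>Norm estimates from the C*-identity\<close>

lemma norm_projection:
  fixes p :: "'a::cstar_algebra"
  assumes "p * p = p" "star p = p" "p \<noteq> 0"
  shows "norm p = 1"
  using norm_star_mult[of p] assms by (simp add: power2_eq_square)

text \<open>Exponents start at 1, because \<open>(h * p) ^ 0\<close> is 1 and not
  \<open>p\<close>.\<close>

lemma power_mult_idempotent:
  fixes h p :: "'a::monoid_mult"
  assumes "p * p = p" "h * p = p * h"
  shows "(h * p) ^ Suc n = h ^ Suc n * p"
proof (induction n)
  case (Suc n)
  have "(h * p) ^ Suc (Suc n) = h * p * (h ^ Suc n * p)" using Suc by simp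
  also have "\<dots> = h * (p * h ^ Suc n) * p" by (simp add: mult.assoc)
  also have "p * h ^ Suc n = h ^ Suc n * p"
    using assms(2) by (metis power_commuting_commutes)
  finally show ?case by (simp add: mult.assoc assms(1))
qed simp

text \<open>The C*-identity applied repeatedly to self-adjoint powers; it reaches only exponents
  that are powers of two, which is enough to compare growth rates.\<close>

lemma norm_self_adjoint_power:
  fixes h :: "'a::cstar_algebra"
  assumes "star h = h"
  shows "norm (h ^ 2 ^ k) = norm h ^ 2 ^ k"
proof (induction k)
  case (Suc k)
  have star_pow: "star (h ^ n) = h ^ n" for n
    by (induction n) (simp_all add: star_mult assms power_commutes)
  have "2 ^ Suc k = 2 ^ k + (2 ^ k :: nat)" by simp
  then have "norm (h ^ 2 ^ Suc k) = norm (star (h ^ 2 ^ k) * h ^ 2 ^ k)"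
    by (simp only: star_pow power_add)
  then show ?case using Suc by (simp only: norm_star_mult flip: power_mult) (simp add: mult.commute)
qed simp

text \<open>Taking roots removes the constant C: if q > m > 0, some power (q / m) ^ n exceeds C, and
  n \<le> 2 ^ n brings the exponent to the required form.\<close>

lemma le_if_powers_le:
  fixes q m C :: real
  assumes "0 \<le> q" "0 \<le> m" and le: "\<And>k. q ^ 2 ^ k \<le> C * m ^ 2 ^ k"
  shows "q \<le> m"
proof (rule ccontr)
  assume "\<not> q \<le> m"
  then have q: "q > m" "q > 0" using assms by auto
  show False
  proof (cases "m = 0")
    case True
    then show ?thesis using le[of 0] q by simp
  next
    case False
    then have m: "m > 0" using assms by simp
    then have r: "q / m > 1" using q by simp
    obtain n where "C < (q / m) ^ n" using real_arch_pow[OF r] by blast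
    also have "(q / m) ^ n \<le> (q / m) ^ 2 ^ n"
      using r by (intro power_increasing) (auto intro: less_imp_le)
    also have "\<dots> \<le> C" using le[of n] m by (simp add: power_divide field_simps)
    finally show False by simp
  qed
qed

text \<open>Since \<open>h = y\<^sup>* y\<close> satisfies \<open>h ^ n = (\<Sum>i. (h p\<^sub>i) ^ n)\<close>, the norm of \<open>h\<close> is at most
  the \<open>n\<close>-th root of \<open>card I\<close> times the maximum of the norms of the \<open>h p\<^sub>i\<close>.\<close>

lemma norm_le_by_blocks:
  fixes y :: "'a::cstar_algebra"
  assumes fin: "finite I" and one: "(\<Sum>i\<in>I. p i) = 1"
    and idem: "\<And>i. i \<in> I \<Longrightarrow> p i * p i = p i"
    and sa: "\<And>i. i \<in> I \<Longrightarrow> star (p i) = p i"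
    and comm: "\<And>i. i \<in> I \<Longrightarrow> y * p i = p i * y"
    and le: "\<And>i. i \<in> I \<Longrightarrow> norm (y * p i) \<le> m"
  shows "norm y \<le> m"
proof -
  define h where "h = star y * y"
  have "I \<noteq> {}" using one by auto
  then have m: "0 \<le> m" using le norm_ge_zero order_trans by blast
  have comm': "star y * p i = p i * star y" if "i \<in> I" for i
    using arg_cong[OF comm[OF that], of star] sa[OF that] by (simp add: star_mult)
  have h_comm: "h * p i = p i * h" if "i \<in> I" for i
    using comm[OF that] comm'[OF that] unfolding h_def by (metis mult.assoc)
  have "norm (h * p i) \<le> m\<^sup>2" if i: "i \<in> I" for i
  proof -
    \<comment> \<open>The block of \<open>h\<close> is again of the form \<open>star x * x\<close>,
      with \<open>x = y * p i\<close>, so the C*-identity computes its norm.\<close>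
    have "star (y * p i) * (y * p i) = h * p i"
      using h_comm[OF i] idem[OF i] sa[OF i] unfolding h_def by (metis mult.assoc star_mult)
    then have "norm (h * p i) = (norm (y * p i))\<^sup>2" by (metis norm_star_mult)
    then show ?thesis using le[OF i] by (simp add: power_mono)
  qed
  note block = this
  have "norm h \<le> m\<^sup>2"
  proof (rule le_if_powers_le)
    fix k :: nat
    obtain n where n: "2 ^ k = Suc n" by (metis power_not_zero zero_neq_numeral not0_implies_Suc)
    have "h ^ Suc n = (\<Sum>i\<in>I. h ^ Suc n * p i)"
      by (simp add: one flip: sum_distrib_left)
    also have "\<dots> = (\<Sum>i\<in>I. (h * p i) ^ Suc n)"
      by (intro sum.cong refl power_mult_idempotent[symmetric] idem h_comm)
    finally have "norm (h ^ Suc n) \<le> (\<Sum>i\<in>I. norm ((h * p i) ^ Suc n))"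
      by (simp only: norm_sum)
    also have "\<dots> \<le> (\<Sum>i\<in>I. (m\<^sup>2) ^ Suc n)"
      by (intro sum_mono order_trans[OF norm_power_ineq] power_mono block norm_ge_zero)
    finally have "norm (h ^ 2 ^ k) \<le> card I * (m\<^sup>2) ^ 2 ^ k" by (simp add: n)
    then show "norm h ^ 2 ^ k \<le> card I * (m\<^sup>2) ^ 2 ^ k"
      by (subst (asm) norm_self_adjoint_power) (simp_all add: h_def star_mult star_star)
  qed auto
  then show ?thesis using m by (simp add: h_def norm_star_mult power2_le_iff_abs_le)
qed

section \<open>Words and matrix units\<close>

abbreviation words :: "nat \<Rightarrow> 3 list set" where
  "words n \<equiv> {\<sigma>. length \<sigma> = n}"

lemma finite_words [simp]: "finite (words n)"
  using finite_lists_length_eq[of "UNIV :: 3 set" n] by simp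

lemma sum_words_append:
  "(\<Sum>\<sigma>\<in>words (n + m). F \<sigma>) = (\<Sum>\<pi>\<in>words n. \<Sum>\<rho>\<in>words m. F (\<pi> @ \<rho>))"
  unfolding sum.cartesian_product
  by (rule sum.reindex_bij_witness[where i = "\<lambda>(\<pi>, \<rho>). \<pi> @ \<rho>" and j = "\<lambda>\<sigma>. (take n \<sigma>, drop n \<sigma>)"])
    auto

lemma sum_words_1: "(\<Sum>\<sigma>\<in>words (Suc 0). F \<sigma>) = (\<Sum>j\<in>UNIV. F [j])"
  by (rule sum.reindex_bij_witness[where i = "\<lambda>j. [j]" and j = hd]) (auto simp: length_Suc_conv)

lemma sum_words_snoc: "(\<Sum>\<sigma>\<in>words (Suc n). F \<sigma>) = (\<Sum>\<pi>\<in>words n. \<Sum>j\<in>UNIV. F (\<pi> @ [j]))"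
  using sum_words_append[of F n 1] by (simp add: sum_words_1)

text \<open>In the type \<open>3\<close> the letter 3 equals 0, so the row of a letter is given by
  cases: the letters 1, 2, 3 own the rows 0, 1, 2, as in \<open>munit\<close>.\<close>

definition digit :: "3 \<Rightarrow> nat" where
  "digit j = (if j = 1 then 0 else if j = 2 then 1 else 2)"

lemma digit_less [simp]: "digit j < 3"
  by (simp add: digit_def)

lemma of_nat_Suc_eq_iff: "r < 3 \<Longrightarrow> of_nat (Suc r) = j \<longleftrightarrow> r = digit j"
proof -
  assume "r < 3"
  then consider "r = 0" | "r = 1" | "r = 2" by linarith
  then show ?thesis
    using exhaust_3[of j] by cases (auto simp: digit_def)
qed

lemma digit_eq_iff [simp]: "digit i = digit j \<longleftrightarrow> i = j"
  using exhaust_3[of i] exhaust_3[of j] by (auto simp: digit_def split: if_splits)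

text \<open>Base 3 with the first letter most significant, to agree with \<open>kron\<close>, where
  the left factor selects the block and the right factor the place inside it.\<close>

fun code :: "3 list \<Rightarrow> nat" where
  "code [] = 0"
| "code (j # \<sigma>) = digit j * 3 ^ length \<sigma> + code \<sigma>"

lemma code_append: "code (\<sigma> @ \<tau>) = code \<sigma> * 3 ^ length \<tau> + code \<tau>"
  by (induction \<sigma>) (simp_all add: power_add algebra_simps)

lemma mult_add_less: "a < n \<Longrightarrow> b < m \<Longrightarrow> a * m + b < n * (m::nat)"
  by (metis add_less_cancel_left less_le_trans mult_Suc mult_le_mono1 Suc_leI add.commute)

lemma code_less: "code \<sigma> < 3 ^ length \<sigma>"
  by (induction \<sigma>) (auto intro: mult_add_less)

lemma mult_add_eq_iff: "b < m \<Longrightarrow> b' < m \<Longrightarrow> a * m + b = a' * m + b' \<longleftrightarrow> a = a' \<and> b = (b'::nat)"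
  by (metis add_diff_cancel_left' div_mult_self3 div_less add.right_neutral not_less_zero gr0I)

lemma code_eq_iff: "length \<sigma> = length \<tau> \<Longrightarrow> code \<sigma> = code \<tau> \<longleftrightarrow> \<sigma> = \<tau>"
proof (induction \<sigma> \<tau> rule: list_induct2)
  case (Cons i \<sigma> j \<tau>)
  then show ?case using code_less[of \<sigma>] code_less[of \<tau>] by (auto simp: mult_add_eq_iff)
qed simp

lemma bij_betw_code: "bij_betw code (words n) {..<3 ^ n}"
proof -
  have inj: "inj_on code (words n)" by (auto simp: inj_on_def code_eq_iff)
  moreover have "code ` words n = {..<3 ^ n}"
  proof (rule card_subset_eq)
    show "code ` words n \<subseteq> {..<3 ^ n}" using code_less by force
    show "card (code ` words n) = card {..<3 ^ n :: nat}"
      using card_image[OF inj] card_lists_length_eq[of "UNIV :: 3 set" n] by simp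
  qed simp
  ultimately show ?thesis by (simp add: bij_betw_def)
qed

text \<open>Matrix units of any size, indexed by rows from 0; every tensor product of the
  \<open>munit\<close> is one of them, at the codes of two words.\<close>

definition unit_mat :: "nat \<Rightarrow> nat \<Rightarrow> nat \<Rightarrow> complex mat" where
  "unit_mat n p q = Matrix.mat n n (\<lambda>(r, c). if r = p \<and> c = q then 1 else 0)"

lemma unit_mat_carrier [simp]: "unit_mat n p q \<in> carrier_mat n n"
  by (simp add: unit_mat_def)

lemma dim_unit_mat [simp]: "dim_row (unit_mat n p q) = n" "dim_col (unit_mat n p q) = n"
  by (simp_all add: unit_mat_def)

lemma index_unit_mat [simp]:
  "r < n \<Longrightarrow> c < n \<Longrightarrow> unit_mat n p q $$ (r, c) = (if r = p \<and> c = q then 1 else 0)"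
  by (simp add: unit_mat_def)

lemma unit_mat_mult:
  assumes "p < n" "q < n" "r < n" "s < n"
  shows "unit_mat n p q * unit_mat n r s = (if q = r then unit_mat n p s else 0\<^sub>m n n)"
  using assms
  by (intro eq_matI) (auto simp: scalar_prod_def if_distrib[of "\<lambda>x. x * _"] if_distrib[of "\<lambda>x. _ * x"] 
      sum.delta cong: if_cong intro!: sum.neutral)

lemma mat_adjoint_unit_mat: "mat_adjoint (unit_mat n p q) = unit_mat n q p"
  by (rule eq_matI) (auto simp: mat_adjoint_def mat_of_rows_def)

section \<open>Kronecker products of matrix units\<close>

lemma dim_kron [simp]:
  "dim_row (A \<otimes>\<^sub>K B) = dim_row A * dim_row B" "dim_col (A \<otimes>\<^sub>K B) = dim_col A * dim_col B"
  by (simp_all add: kron_def)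

lemma index_kron [simp]:
  "r < dim_row A * dim_row B \<Longrightarrow> c < dim_col A * dim_col B \<Longrightarrow> (A \<otimes>\<^sub>K B) $$ (r, c) =
    A $$ (r div dim_row B, c div dim_col B) * B $$ (r mod dim_row B, c mod dim_col B)"
  by (simp add: kron_def)

lemma kron_carrier:
  "A \<in> carrier_mat n m \<Longrightarrow> B \<in> carrier_mat n' m' \<Longrightarrow> A \<otimes>\<^sub>K B \<in> carrier_mat (n * n') (m * m')"
  by (intro carrier_matI) auto

lemma div_mod_less: "(r::nat) < n * m \<Longrightarrow> r div m < n \<and> r mod m < m"
  by (cases "m = 0") (auto simp: less_mult_imp_div_less)

lemma kron_add_left:
  assumes "A \<in> carrier_mat n m" "B \<in> carrier_mat n m"
  shows "(A + B) \<otimes>\<^sub>K C = A \<otimes>\<^sub>K C + B \<otimes>\<^sub>K C"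
  using assms by (intro eq_matI) (auto simp: distrib_right dest!: div_mod_less)

lemma kron_add_right:
  assumes "A \<in> carrier_mat n m" "B \<in> carrier_mat n m"
  shows "C \<otimes>\<^sub>K (A + B) = C \<otimes>\<^sub>K A + C \<otimes>\<^sub>K B"
  using assms by (intro eq_matI) (auto simp: distrib_left dest!: div_mod_less)

lemma kron_smult_left: "(c \<cdot>\<^sub>m A) \<otimes>\<^sub>K B = c \<cdot>\<^sub>m (A \<otimes>\<^sub>K B)"
  by (intro eq_matI) (auto dest!: div_mod_less)

lemma kron_unit_mat:
  assumes "p < n" "q < n" "r < m" "s < m"
  shows "unit_mat n p q \<otimes>\<^sub>K unit_mat m r s = unit_mat (n * m) (p * m + r) (q * m + s)"
proof (rule eq_matI)
  fix a b
  assume "a < dim_row (unit_mat (n * m) (p * m + r) (q * m + s))"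
    and "b < dim_col (unit_mat (n * m) (p * m + r) (q * m + s))"
  then have ab: "a < n * m" "b < n * m" by auto
  have iff: "x = y * m + z \<longleftrightarrow> x div m = y \<and> x mod m = z" if "z < m" for x y z
    using that by auto
  show "(unit_mat n p q \<otimes>\<^sub>K unit_mat m r s) $$ (a, b)
      = unit_mat (n * m) (p * m + r) (q * m + s) $$ (a, b)"
    using ab assms div_mod_less[OF ab(1)] div_mod_less[OF ab(2)] by (auto simp: iff)
qed simp_all

lemma munit_eq_unit_mat: "munit i j = unit_mat 3 (digit i) (digit j)"
  unfolding munit_def unit_mat_def
  by (rule eq_matI) (simp_all add: of_nat_Suc_eq_iff del: of_nat_Suc)

lemma kron_list_munit:
  "kron_list (map (\<lambda>j. munit j j) \<sigma>) = unit_mat (3 ^ length \<sigma>) (code \<sigma>) (code \<sigma>)"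
proof (induction \<sigma>)
  case Nil
  show ?case by (rule eq_matI) (auto simp: kron_list_def)
next
  case (Cons j \<sigma>)
  then show ?case
    by (simp add: kron_list_def munit_eq_unit_mat kron_unit_mat code_less)
qed

lemma kron_list_replicate_munit:
  "kron_list (replicate n (munit j j)) = unit_mat (3 ^ n) (code (replicate n j)) (code (replicate n j))"
  using kron_list_munit[of "replicate n j"] by simp

lemma kron_unit_mat_code:
  assumes "length \<sigma> = length \<tau>" "length \<sigma>' = length \<tau>'"
  shows "unit_mat (3 ^ length \<sigma>) (code \<sigma>) (code \<tau>) \<otimes>\<^sub>K unit_mat (3 ^ length \<sigma>') (code \<sigma>') (code \<tau>')
    = unit_mat (3 ^ length (\<sigma> @ \<sigma>')) (code (\<sigma> @ \<sigma>')) (code (\<tau> @ \<tau>'))"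
  using assms code_less[of \<sigma>] code_less[of \<sigma>'] code_less[of \<tau>] code_less[of \<tau>']
  by (simp add: kron_unit_mat code_append power_add)

lemma munit_code: "munit i j = unit_mat (3 ^ length [i]) (code [i]) (code [j])"
  by (simp add: munit_eq_unit_mat)

lemma alpha_eq_unit_mat:
  "alpha n j = unit_mat (3 ^ Suc n) (code (j # replicate n 2)) (code (j # replicate n 2))"
  using kron_unit_mat_code[of "[j]" "[j]" "replicate n 2" "replicate n 2"]
  unfolding alpha_def kron_list_replicate_munit munit_code[of j] by simp

text \<open>The two tails that appear are the two codes of one vertex of the gasket. This is where
  the gluing condition enters the algebra.\<close>

lemma kron_beta:
  fixes \<sigma> \<tau> :: "3 list"
  assumes len: "length \<tau> = length \<sigma>" and k: "k \<ge> 1"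
  shows "unit_mat (3 ^ length \<sigma>) (code \<sigma>) (code \<tau>) \<otimes>\<^sub>K beta k j =
    unit_mat (3 ^ (length \<sigma> + Suc k)) (code (\<sigma> @ j # 1 # replicate (k - 1) 2))
      (code (\<tau> @ j # 1 # replicate (k - 1) 2)) +
    unit_mat (3 ^ (length \<sigma> + Suc k)) (code (\<sigma> @ (j + 2) # 3 # replicate (k - 1) 2))
      (code (\<tau> @ (j + 2) # 3 # replicate (k - 1) 2))"
proof -
  have munit2: "munit i i \<otimes>\<^sub>K munit l l = unit_mat (3 ^ length [i, l]) (code [i, l]) (code [i, l])"
    for i l
    using kron_unit_mat_code[of "[i]" "[i]" "[l]" "[l]"] by (simp add: munit_code)
  let ?u = "\<lambda>\<sigma>. unit_mat (3 ^ length \<sigma>) (code \<sigma>) (code \<sigma>)"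
  let ?r = "replicate (k - 1) (2::3)"
  have rep: "kron_list (replicate (k - 1) (munit 2 2)) = ?u ?r"
    by (simp add: kron_list_replicate_munit)
  have "beta k j = ?u ([j, 1] @ ?r) + ?u ([j + 2, 3] @ ?r)"
    unfolding beta_def munit2 rep
    by (subst kron_add_left[of _ 9 9]) (simp_all only: kron_unit_mat_code, simp_all)
  then have "unit_mat (3 ^ length \<sigma>) (code \<sigma>) (code \<tau>) \<otimes>\<^sub>K beta k j =
    unit_mat (3 ^ length \<sigma>) (code \<sigma>) (code \<tau>) \<otimes>\<^sub>K ?u ([j, 1] @ ?r) +
    unit_mat (3 ^ length \<sigma>) (code \<sigma>) (code \<tau>) \<otimes>\<^sub>K ?u ([j + 2, 3] @ ?r)"
    by (simp only:) (rule kron_add_right[of _ "3 ^ Suc k" "3 ^ Suc k"], use k in simp_all)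
  then show ?thesis
    using k by (simp only: kron_unit_mat_code len) (simp add: power_add)
qed

text \<open>Additivity is available only on matrices of the right dimension, so the induction runs
  over sets S of positions, with \<open>R S\<close> the matrix that keeps the entries of
  \<open>A\<close> in S.\<close>

lemma linear_on_mat_eq_sum:
  fixes \<phi> :: "complex mat \<Rightarrow> 'a::cstar_algebra"
  assumes add: "\<And>A B. A \<in> carrier_mat n n \<Longrightarrow> B \<in> carrier_mat n n \<Longrightarrow> \<phi> (A + B) = \<phi> A + \<phi> B"
    and smult: "\<And>c A. A \<in> carrier_mat n n \<Longrightarrow> \<phi> (c \<cdot>\<^sub>m A) = c *\<^sub>C \<phi> A"
    and A: "A \<in> carrier_mat n n"
  shows "\<phi> A = (\<Sum>p<n. \<Sum>q<n. A $$ (p, q) *\<^sub>C \<phi> (unit_mat n p q))"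
proof -
  define R where "R S = Matrix.mat n n (\<lambda>(r, c). if (r, c) \<in> S then A $$ (r, c) else 0)" for S
  have zero: "\<phi> (0\<^sub>m n n) = 0"
  proof -
    have "0\<^sub>m n n = 0 \<cdot>\<^sub>m (0\<^sub>m n n :: complex mat)" by (rule eq_matI) auto
    then show ?thesis using smult[of "0\<^sub>m n n" 0] by simp
  qed
  have "\<phi> (R S) = (\<Sum>(p, q)\<in>S. A $$ (p, q) *\<^sub>C \<phi> (unit_mat n p q))"
    if "finite S" "S \<subseteq> {..<n} \<times> {..<n}" for S
    using that
  proof (induction S rule: finite_induct)
    case empty
    have "R {} = 0\<^sub>m n n" by (rule eq_matI) (auto simp: R_def)
    then show ?case by (simp add: zero)
  next
    case (insert x S)
    obtain p q where x: "x = (p, q)" by fastforce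
    have "R (insert x S) = A $$ (p, q) \<cdot>\<^sub>m unit_mat n p q + R S"
      using insert by (intro eq_matI) (auto simp: R_def x)
    then have "\<phi> (R (insert x S)) = A $$ (p, q) *\<^sub>C \<phi> (unit_mat n p q) + \<phi> (R S)"
      by (simp add: add smult R_def)
    then show ?case using insert by (simp add: x)
  qed
  from this[of "{..<n} \<times> {..<n}"] have "\<phi> (R ({..<n} \<times> {..<n})) =
      (\<Sum>p<n. \<Sum>q<n. A $$ (p, q) *\<^sub>C \<phi> (unit_mat n p q))"
    by (simp add: sum.cartesian_product)
  moreover have "R ({..<n} \<times> {..<n}) = A"
    using A by (intro eq_matI) (auto simp: R_def)
  ultimately show ?thesis by simp
qed

section \<open>Matrix units of the inductive limit\<close>

context uhf_3_infinity
begin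

text \<open>With words as labels, appending letters is the tensor product, and the inclusion
  \<open>x \<mapsto> x \<otimes> I\<close> becomes a sum over common suffixes
  (\<open>E_append\<close>).\<close>

definition E :: "3 list \<Rightarrow> 3 list \<Rightarrow> 'u" where
  "E \<sigma> \<tau> = \<iota> (length \<sigma>) (unit_mat (3 ^ length \<sigma>) (code \<sigma>) (code \<tau>))"

lemma incl_zero: "\<iota> n (0\<^sub>m (3 ^ n) (3 ^ n)) = 0"
proof -
  have "0\<^sub>m (3 ^ n) (3 ^ n) = 0 \<cdot>\<^sub>m (0\<^sub>m (3 ^ n) (3 ^ n) :: complex mat)" by (rule eq_matI) auto
  then show ?thesis using incl_smult[of "0\<^sub>m (3 ^ n) (3 ^ n)" n 0] by simp
qed

lemma E_mult:
  assumes "length \<sigma> = n" "length \<tau> = n" "length \<sigma>' = n" "length \<tau>' = n"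
  shows "E \<sigma> \<tau> * E \<sigma>' \<tau>' = (if \<tau> = \<sigma>' then E \<sigma> \<tau>' else 0)"
proof -
  have "code \<rho> < 3 ^ n" if "length \<rho> = n" for \<rho> using code_less[of \<rho>] that by simp
  then show ?thesis
    using assms code_eq_iff[of \<tau> \<sigma>']
    by (auto simp: E_def unit_mat_mult incl_zero simp flip: incl_mult)
qed

lemma star_E: "length \<sigma> = length \<tau> \<Longrightarrow> star (E \<sigma> \<tau>) = E \<tau> \<sigma>"
  by (simp add: E_def mat_adjoint_unit_mat flip: incl_adjoint)

lemma E_Nil [simp]: "E [] [] = 1"
proof -
  have "unit_mat 1 0 0 = 1\<^sub>m (3 ^ 0)" by (rule eq_matI) auto
  then show ?thesis using incl_one[of 0] by (simp add: E_def)
qed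

lemma E_split:
  assumes "length \<sigma> = length \<tau>"
  shows "E \<sigma> \<tau> = (\<Sum>j\<in>UNIV. E (\<sigma> @ [j]) (\<tau> @ [j]))"
proof -
  let ?n = "length \<sigma>"
  let ?u = "unit_mat (3 ^ ?n) (code \<sigma>) (code \<tau>)"
  have one: "1\<^sub>m 3 = munit 1 1 + munit 2 2 + munit 3 3"
    by (rule eq_matI) (auto simp: munit_eq_unit_mat digit_def)
  have "?u \<otimes>\<^sub>K 1\<^sub>m 3 = ?u \<otimes>\<^sub>K munit 1 1 + ?u \<otimes>\<^sub>K munit 2 2 + ?u \<otimes>\<^sub>K munit 3 3"
    unfolding one
    by (subst kron_add_right[of _ 3 3], simp_all add: munit_eq_unit_mat)
      (subst kron_add_right[of _ 3 3], simp_all)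
  moreover have "?u \<otimes>\<^sub>K munit j j =
      unit_mat (3 ^ Suc ?n) (code (\<sigma> @ [j])) (code (\<tau> @ [j]))" for j
    using kron_unit_mat_code[of \<sigma> \<tau> "[j]" "[j]"] assms by (simp add: munit_code)
  ultimately have "E \<sigma> \<tau> = \<iota> (Suc ?n)
    (unit_mat (3 ^ Suc ?n) (code (\<sigma> @ [1])) (code (\<tau> @ [1])) +
     unit_mat (3 ^ Suc ?n) (code (\<sigma> @ [2])) (code (\<tau> @ [2])) +
     unit_mat (3 ^ Suc ?n) (code (\<sigma> @ [3])) (code (\<tau> @ [3])))"
    using incl_compat[of ?u ?n] by (simp only: E_def unit_mat_carrier)
  also have "\<dots> = E (\<sigma> @ [1]) (\<tau> @ [1]) + E (\<sigma> @ [2]) (\<tau> @ [2]) + E (\<sigma> @ [3]) (\<tau> @ [3])"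
    by (simp only: E_def length_append_singleton incl_add unit_mat_carrier add_carrier_mat)
  finally show ?thesis by (simp only: sum_3)
qed

lemma E_append:
  assumes "length \<sigma> = length \<tau>"
  shows "E \<sigma> \<tau> = (\<Sum>\<rho>\<in>words m. E (\<sigma> @ \<rho>) (\<tau> @ \<rho>))"
proof (induction m)
  case (Suc m)
  have "(\<Sum>j\<in>UNIV. E (\<sigma> @ \<rho> @ [j]) (\<tau> @ \<rho> @ [j])) = E (\<sigma> @ \<rho>) (\<tau> @ \<rho>)" for \<rho>
    using E_split[of "\<sigma> @ \<rho>" "\<tau> @ \<rho>"] assms by simp
  then show ?case unfolding sum_words_snoc by (subst Suc) (simp only: append_assoc)
qed simp

lemma sum_E: "(\<Sum>\<sigma>\<in>words n. E \<sigma> \<sigma>) = 1"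
  using E_append[of "[]" "[]" n] by simp

lemma E_neq_0:
  assumes "length \<sigma> = length \<tau>"
  shows "E \<sigma> \<tau> \<noteq> 0"
proof
  let ?n = "3 ^ length \<sigma>"
  assume "E \<sigma> \<tau> = 0"
  then have "unit_mat ?n (code \<sigma>) (code \<tau>) = 0\<^sub>m ?n ?n"
    using incl_zero[of "length \<sigma>"] by (intro inj_onD[OF incl_inj[of "length \<sigma>"]]) (auto simp: E_def)
  then have "unit_mat ?n (code \<sigma>) (code \<tau>) $$ (code \<sigma>, code \<tau>) = 0\<^sub>m ?n ?n $$ (code \<sigma>, code \<tau>)"
    by simp
  then show False using assms code_less[of \<sigma>] code_less[of \<tau>] by simp
qed

lemma norm_E [simp]:
  assumes "length \<sigma> = length \<tau>"
  shows "norm (E \<sigma> \<tau>) = 1"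
proof -
  have "norm (E \<tau> \<tau>) = 1"
    by (rule norm_projection) (simp_all add: star_E E_mult E_neq_0)
  \<comment> \<open>A partial isometry: \<open>star (E \<sigma> \<tau>) * E \<sigma> \<tau>\<close>
    is the projection \<open>E \<tau> \<tau>\<close>.\<close>
  then have "(norm (E \<sigma> \<tau>))\<^sup>2 = 1"
    using assms by (simp add: star_E E_mult flip: norm_star_mult)
  then show ?thesis using norm_ge_zero[of "E \<sigma> \<tau>"] by (auto simp: power2_eq_1_iff)
qed

section \<open>The finite levels and the generators of A_n\<close>

definition fin_alg :: "nat \<Rightarrow> 'u set" where
  "fin_alg n = complex_vector.span {E \<sigma> \<tau> | \<sigma> \<tau>. length \<sigma> = n \<and> length \<tau> = n}"

lemma sum_code: "(\<Sum>p<3 ^ n. f p) = (\<Sum>\<sigma>\<in>words n. f (code \<sigma>))"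
  by (rule sum.reindex_bij_betw[OF bij_betw_code, symmetric])

lemma incl_eq_sum:
  assumes "A \<in> carrier_mat (3 ^ n) (3 ^ n)"
  shows "\<iota> n A = (\<Sum>\<sigma>\<in>words n. \<Sum>\<tau>\<in>words n. A $$ (code \<sigma>, code \<tau>) *\<^sub>C E \<sigma> \<tau>)"
  using linear_on_mat_eq_sum[of "3 ^ n" "\<iota> n", OF incl_add[of _ n] incl_smult[of _ n] assms]
  by (simp add: sum_code E_def)

lemma incl_in_fin_alg: "A \<in> carrier_mat (3 ^ n) (3 ^ n) \<Longrightarrow> \<iota> n A \<in> fin_alg n"
  unfolding incl_eq_sum fin_alg_def
  by (intro complex_vector.span_sum complex_vector.span_scale complex_vector.span_base) auto

lemma fin_alg_dense:
  assumes "e > 0"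
  obtains n b where "b \<in> fin_alg n" "norm (a - b) < e"
proof -
  have "a \<in> closure (\<Union>n. \<iota> n ` carrier_mat (3 ^ n) (3 ^ n))" by (simp add: incl_dense)
  then obtain n A where "A \<in> carrier_mat (3 ^ n) (3 ^ n)" "dist (\<iota> n A) a < e"
    using assms unfolding closure_approachable by blast
  then show thesis
    using that[of "\<iota> n A" n] incl_in_fin_alg by (simp add: dist_norm norm_minus_commute)
qed

text \<open>The generators with x restricted to matrix units. Here \<open>k\<close> counts the
  trailing letters 2 and starts at 0, so it is one less than the index of \<beta>; all words have
  length \<open>n + 1\<close>.\<close>

definition A_gens :: "nat \<Rightarrow> 'u set" where
  "A_gens n = {E (j # replicate n 2) (j # replicate n 2) | j. True} \<union>
    {E (\<sigma> @ j # 1 # replicate k 2) (\<tau> @ j # 1 # replicate k 2) +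
     E (\<sigma> @ (j + 2) # 3 # replicate k 2) (\<tau> @ (j + 2) # 3 # replicate k 2) | \<sigma> \<tau> j k.
     length \<sigma> + k + 1 = n \<and> length \<tau> = length \<sigma>}"

lemma A_gens_pair:
  assumes "length \<sigma> + k + 1 = n" "length \<tau> = length \<sigma>"
  shows "E (\<sigma> @ j # 1 # replicate k 2) (\<tau> @ j # 1 # replicate k 2) +
     E (\<sigma> @ (j + 2) # 3 # replicate k 2) (\<tau> @ (j + 2) # 3 # replicate k 2) \<in> A_gens n"
  unfolding A_gens_def
  by (intro UnI2 CollectI exI[of _ \<sigma>] exI[of _ \<tau>] exI[of _ j] exI[of _ k] conjI refl assms)

lemma A_gens_vertex: "E (j # replicate n 2) (j # replicate n 2) \<in> A_gens n"
  unfolding A_gens_def by blast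

lemma incl_kron_beta:
  assumes "length \<tau> = length \<sigma>" "k \<ge> 1" "length \<sigma> + k = n"
  shows "\<iota> (Suc n) (unit_mat (3 ^ length \<sigma>) (code \<sigma>) (code \<tau>) \<otimes>\<^sub>K beta k j) =
    E (\<sigma> @ j # 1 # replicate (k - 1) 2) (\<tau> @ j # 1 # replicate (k - 1) 2) +
    E (\<sigma> @ (j + 2) # 3 # replicate (k - 1) 2) (\<tau> @ (j + 2) # 3 # replicate (k - 1) 2)"
proof -
  have len: "length (\<sigma> @ i # l # replicate (k - 1) 2) = Suc n" for i l :: 3
    using assms by simp
  have n: "length \<sigma> + Suc k = Suc n" using assms by simp
  show ?thesis unfolding kron_beta[OF assms(1,2)] E_def len n
    by (rule incl_add) simp_all
qed

lemma beta_carrier: "k \<ge> 1 \<Longrightarrow> beta k j \<in> carrier_mat (3 ^ Suc k) (3 ^ Suc k)"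
  unfolding beta_def kron_list_replicate_munit
  by (cases k) (auto simp: munit_def intro!: carrier_matI)

lemma A_fin_eq_span: "A_fin \<iota> n = complex_vector.span (A_gens n)"
proof (rule antisym)
  have "\<iota> (Suc n) (x \<otimes>\<^sub>K beta k j) \<in> complex_vector.span (A_gens n)"
    if k: "k \<in> {1..n}" and x: "x \<in> carrier_mat (3 ^ (n - k)) (3 ^ (n - k))" for j k x
  proof -
    let ?N = "3 ^ (n - k)"
    have N: "?N * 3 ^ Suc k = (3::nat) ^ Suc n" using k by (simp flip: power_add)
    have carr: "y \<otimes>\<^sub>K beta k j \<in> carrier_mat (3 ^ Suc n) (3 ^ Suc n)" if "y \<in> carrier_mat ?N ?N" for y
      using kron_carrier[OF that beta_carrier[of k j]] k unfolding N by simp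
    have "\<iota> (Suc n) (x \<otimes>\<^sub>K beta k j) =
      (\<Sum>p<?N. \<Sum>q<?N. x $$ (p, q) *\<^sub>C \<iota> (Suc n) (unit_mat ?N p q \<otimes>\<^sub>K beta k j))"
    \<comment> \<open>Linearity in x reduces the generator to matrix units x.\<close>
    proof (rule linear_on_mat_eq_sum[where \<phi> = "\<lambda>y. \<iota> (Suc n) (y \<otimes>\<^sub>K beta k j)", OF _ _ x])
      fix y z :: "complex mat" assume yz: "y \<in> carrier_mat ?N ?N" "z \<in> carrier_mat ?N ?N"
      show "\<iota> (Suc n) ((y + z) \<otimes>\<^sub>K beta k j) = \<iota> (Suc n) (y \<otimes>\<^sub>K beta k j) + \<iota> (Suc n) (z \<otimes>\<^sub>K beta k j)"
        unfolding kron_add_left[OF yz] by (rule incl_add[OF carr[OF yz(1)] carr[OF yz(2)]])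
      show "\<iota> (Suc n) ((c \<cdot>\<^sub>m y) \<otimes>\<^sub>K beta k j) = c *\<^sub>C \<iota> (Suc n) (y \<otimes>\<^sub>K beta k j)" for c
        unfolding kron_smult_left by (rule incl_smult[OF carr[OF yz(1)]])
    qed
    also have "\<dots> = (\<Sum>\<sigma>\<in>words (n - k). \<Sum>\<tau>\<in>words (n - k). x $$ (code \<sigma>, code \<tau>) *\<^sub>C
        \<iota> (Suc n) (unit_mat ?N (code \<sigma>) (code \<tau>) \<otimes>\<^sub>K beta k j))"
      by (simp only: sum_code)
    also have "\<dots> \<in> complex_vector.span (A_gens n)"
    proof (intro complex_vector.span_sum complex_vector.span_scale complex_vector.span_base)
      fix \<sigma> \<tau> assume st: "\<sigma> \<in> words (n - k)" "\<tau> \<in> words (n - k)"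
      then have "\<iota> (Suc n) (unit_mat ?N (code \<sigma>) (code \<tau>) \<otimes>\<^sub>K beta k j) =
        E (\<sigma> @ j # 1 # replicate (k - 1) 2) (\<tau> @ j # 1 # replicate (k - 1) 2) +
        E (\<sigma> @ (j + 2) # 3 # replicate (k - 1) 2) (\<tau> @ (j + 2) # 3 # replicate (k - 1) 2)"
        using incl_kron_beta[of \<tau> \<sigma> k n j] k by simp
      moreover have "length \<sigma> + (k - 1) + 1 = n" using st k by simp
      ultimately show "\<iota> (Suc n) (unit_mat ?N (code \<sigma>) (code \<tau>) \<otimes>\<^sub>K beta k j) \<in> A_gens n"
        using st by (simp only: A_gens_pair mem_Collect_eq)
    qed
    finally show ?thesis .
  qed
  moreover have "\<iota> (Suc n) (alpha n j) \<in> complex_vector.span (A_gens n)" for j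
  proof -
    have "\<iota> (Suc n) (alpha n j) = E (j # replicate n 2) (j # replicate n 2)"
      by (simp add: alpha_eq_unit_mat E_def)
    then show ?thesis by (simp only: complex_vector.span_base A_gens_vertex)
  qed
  ultimately show "A_fin \<iota> n \<subseteq> complex_vector.span (A_gens n)"
    unfolding A_fin_def by (intro complex_vector.span_minimal) auto
next
  have "E (\<sigma> @ j # 1 # replicate k 2) (\<tau> @ j # 1 # replicate k 2) +
     E (\<sigma> @ (j + 2) # 3 # replicate k 2) (\<tau> @ (j + 2) # 3 # replicate k 2) \<in> A_fin \<iota> n"
    if "length \<sigma> + k + 1 = n" "length \<tau> = length \<sigma>" for \<sigma> \<tau> j k
  proof -
    have ls: "length \<sigma> = n - Suc k" using that by simp
    show ?thesis
      using incl_kron_beta[of \<tau> \<sigma> "Suc k" n j] that unfolding A_fin_def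
      by (intro complex_vector.span_base UnI2 CollectI exI[of _ j] exI[of _ "Suc k"]
          exI[of _ "unit_mat (3 ^ length \<sigma>) (code \<sigma>) (code \<tau>)"]) (auto simp: ls)
  qed
  moreover have "E (j # replicate n 2) (j # replicate n 2) \<in> A_fin \<iota> n" for j
  proof -
    have "\<iota> (Suc n) (alpha n j) = E (j # replicate n 2) (j # replicate n 2)"
      by (simp add: alpha_eq_unit_mat E_def)
    then show ?thesis
      unfolding A_fin_def by (intro complex_vector.span_base UnI1 CollectI exI[of _ j]) simp
  qed
  ultimately have "A_gens n \<subseteq> A_fin \<iota> n"
    unfolding A_gens_def by blast
  moreover have "complex_vector.subspace (A_fin \<iota> n)"
    unfolding A_fin_def by (rule complex_vector.subspace_span)
  ultimately show "complex_vector.span (A_gens n) \<subseteq> A_fin \<iota> n"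
    by (rule complex_vector.span_minimal)
qed

end

section \<open>Functions on infinite words\<close>

definition prepend :: "3 list \<Rightarrow> (nat \<Rightarrow> 3) \<Rightarrow> nat \<Rightarrow> 3" where
  "prepend u \<sigma> = (\<lambda>i. if i < length u then u ! i else \<sigma> (i - length u))"

text \<open>The words ending in \<open>2\<^sup>\<infinity>\<close> code the vertices of the cells of the gasket.\<close>

abbreviation vertex_word :: "3 list \<Rightarrow> nat \<Rightarrow> 3" where
  "vertex_word u \<equiv> prepend u (\<lambda>_. 2)"

text \<open>Uniform continuity with respect to common prefixes. By compactness of the space of words
  this is continuity, and it is the form in which functions are approximated by functions of
  finitely many letters.\<close>

definition continuous_on_words :: "((nat \<Rightarrow> 3) \<Rightarrow> complex) \<Rightarrow> bool" where
  "continuous_on_words g \<longleftrightarrow>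
     (\<forall>e>0. \<exists>n. \<forall>\<sigma> \<tau>. (\<forall>i<n. \<sigma> i = \<tau> i) \<longrightarrow> cmod (g \<sigma> - g \<tau>) < e)"

definition glued :: "((nat \<Rightarrow> 3) \<Rightarrow> complex) \<Rightarrow> bool" where
  "glued g \<longleftrightarrow> (\<forall>u j. g (vertex_word (u @ [j, 1])) = g (vertex_word (u @ [j + 2, 3])))"

lemma prepend_Nil [simp]: "prepend [] \<sigma> = \<sigma>"
  by (simp add: prepend_def)

lemma prepend_Cons_0 [simp]: "prepend (j # u) \<sigma> 0 = j"
  by (simp add: prepend_def)

lemma prepend_Cons_Suc [simp]: "prepend (j # u) \<sigma> (Suc n) = prepend u \<sigma> n"
  by (simp add: prepend_def)

lemma prepend_nth: "i < length u \<Longrightarrow> prepend u \<sigma> i = u ! i"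
  by (simp add: prepend_def)

lemma prepend_append: "prepend (u @ u') \<sigma> = prepend u (prepend u' \<sigma>)"
  by (auto simp: prepend_def fun_eq_iff nth_append)

lemma prepend_map_upt: "prepend (map \<sigma> [0..<n]) (\<lambda>i. \<sigma> (i + n)) = \<sigma>"
  by (auto simp: prepend_def fun_eq_iff)

lemma vertex_word_append_2 [simp]: "vertex_word (u @ [2]) = vertex_word u"
  by (auto simp: prepend_def fun_eq_iff nth_append)

lemma prepend_word_2: "\<tau> 0 = c \<Longrightarrow> (\<And>n. \<tau> (Suc n) = 2) \<Longrightarrow> \<tau> = vertex_word [c]"
  by (auto simp: prepend_def fun_eq_iff) (metis Suc_pred)

section \<open>The coding of the gasket\<close>

lemma linear_real2_cramer:
  fixes a b y :: "real^2"
  assumes D: "D = a$1 * b$2 - a$2 * b$1" "D \<noteq> 0"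
  shows "y = ((y$1 * b$2 - y$2 * b$1) / D) *\<^sub>R a + ((a$1 * y$2 - a$2 * y$1) / D) *\<^sub>R b"
proof -
  have "D * y$1 = (y$1 * b$2 - y$2 * b$1) * a$1 + (a$1 * y$2 - a$2 * y$1) * b$1"
    and "D * y$2 = (y$1 * b$2 - y$2 * b$1) * a$2 + (a$1 * y$2 - a$2 * y$1) * b$2"
    unfolding D(1) by (simp_all add: algebra_simps)
  then have "((y$1 * b$2 - y$2 * b$1) * a$1 + (a$1 * y$2 - a$2 * y$1) * b$1) / D = y$1"
    and "((y$1 * b$2 - y$2 * b$1) * a$2 + (a$1 * y$2 - a$2 * y$1) * b$2) / D = y$2"
    using D(2) by (metis nonzero_mult_div_cancel_left)+
  then show ?thesis
    by (simp add: Finite_Cartesian_Product.vec_eq_iff forall_2 add_divide_distrib)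
qed

section \<open>Barycentric coordinates and the three similitudes\<close>

locale gasket =
  fixes v :: "3 \<Rightarrow> real^2" and w :: "3 \<Rightarrow> real^2 \<Rightarrow> real^2" and K :: "(real^2) set"
  assumes equilateral: "equilateral_triangle v" and maps: "gasket_maps v w"
    and gasket: "is_gasket w K"
begin

text \<open>Twice the oriented area of the triangle.\<close>

definition area :: real where
  "area = (v 1 - v 3)$1 * (v 2 - v 3)$2 - (v 1 - v 3)$2 * (v 2 - v 3)$1"

text \<open>The barycentric coordinates by Cramer's rule; the determinants make continuity
  evident.\<close>

definition bary :: "3 \<Rightarrow> real^2 \<Rightarrow> real" where
  "bary j x =
    (let s = ((x - v 3)$1 * (v 2 - v 3)$2 - (x - v 3)$2 * (v 2 - v 3)$1) / area;
         t = ((v 1 - v 3)$1 * (x - v 3)$2 - (v 1 - v 3)$2 * (x - v 3)$1) / area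
     in if j = 1 then s else if j = 2 then t else 1 - s - t)"

text \<open>Lagrange's identity: |a|^2 |b|^2 is the square of the inner product plus the square of
  the determinant. Equal sides make the inner product S / 2 with S = |a|^2 = |b|^2, so a zero
  determinant would give S^2 = S^2 / 4.\<close>

lemma area_neq_0: "area \<noteq> 0"
proof
  define a b where "a = v 1 - v 3" and "b = v 2 - v 3"
  assume "area = 0"
  then have *: "a$1 * b$2 = a$2 * b$1" by (simp add: area_def a_def b_def)
  have n: "norm a = norm b" "norm (a - b) = norm b" "b \<noteq> 0"
    using equilateral
    by (auto simp: equilateral_triangle_def a_def b_def dist_norm norm_minus_commute)
  have sq: "(norm x)\<^sup>2 = (x$1)\<^sup>2 + (x$2)\<^sup>2" for x :: "real^2"
    unfolding power2_norm_eq_inner by (simp add: inner_vec_def sum_2 power2_eq_square)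
  define S where "S = (b$1)\<^sup>2 + (b$2)\<^sup>2"
  have 1: "(a$1)\<^sup>2 + (a$2)\<^sup>2 = S" using n(1) sq[of a] sq[of b] by (simp add: S_def)
  have 2: "(a$1 - b$1)\<^sup>2 + (a$2 - b$2)\<^sup>2 = S"
    using n(2) sq[of "a - b"] sq[of b] by (simp add: S_def)
  have 3: "2 * (a$1 * b$1 + a$2 * b$2) = S"
    using 1 2 unfolding S_def by (simp add: power2_diff algebra_simps)
  have "S * S = ((a$1)\<^sup>2 + (a$2)\<^sup>2) * ((b$1)\<^sup>2 + (b$2)\<^sup>2)"
    unfolding 1 S_def ..
  also have "\<dots> = (a$1 * b$1 + a$2 * b$2)\<^sup>2 + (a$1 * b$2 - a$2 * b$1)\<^sup>2"
    by (simp add: power2_eq_square algebra_simps)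
  also have "a$1 * b$1 + a$2 * b$2 = S / 2" using 3 by simp
  also have "a$1 * b$2 - a$2 * b$1 = 0" using * by simp
  finally have "S = 0" by (simp add: power2_eq_square)
  then show False using n(3) sq[of b] by (simp add: S_def)
qed

lemma sum_bary: "bary 1 x + bary 2 x + bary 3 x = 1"
  by (simp add: bary_def Let_def)

lemma bary_combination: "x = bary 1 x *\<^sub>R v 1 + bary 2 x *\<^sub>R v 2 + bary 3 x *\<^sub>R v 3"
proof -
  have b: "bary 1 x = ((x - v 3)$1 * (v 2 - v 3)$2 - (x - v 3)$2 * (v 2 - v 3)$1) / area"
    "bary 2 x = ((v 1 - v 3)$1 * (x - v 3)$2 - (v 1 - v 3)$2 * (x - v 3)$1) / area"
    by (simp_all add: bary_def)
  have "x - v 3 = bary 1 x *\<^sub>R (v 1 - v 3) + bary 2 x *\<^sub>R (v 2 - v 3)"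
    unfolding b by (rule linear_real2_cramer[OF area_def area_neq_0])
  moreover have b3: "bary 3 x = 1 - bary 1 x - bary 2 x" using sum_bary[of x] by simp
  ultimately show ?thesis unfolding b3 by (simp add: algebra_simps)
qed

lemma bary_eqI:
  assumes "x = r *\<^sub>R v 1 + s *\<^sub>R v 2 + t *\<^sub>R v 3" "r + s + t = 1"
  shows "bary 1 x = r" "bary 2 x = s" "bary 3 x = t"
proof -
  have t: "t = 1 - r - s" using assms by simp
  have x: "x - v 3 = r *\<^sub>R (v 1 - v 3) + s *\<^sub>R (v 2 - v 3)"
    unfolding assms(1) t by (simp add: algebra_simps)
  have "(x - v 3)$1 * (v 2 - v 3)$2 - (x - v 3)$2 * (v 2 - v 3)$1 = r * area"
    "(v 1 - v 3)$1 * (x - v 3)$2 - (v 1 - v 3)$2 * (x - v 3)$1 = s * area"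
    unfolding x area_def by (simp_all add: algebra_simps)
  then show 12: "bary 1 x = r" "bary 2 x = s"
    using area_neq_0 by (simp_all add: bary_def)
  then show "bary 3 x = t" using sum_bary[of x] t by simp
qed

lemma bary_vertex: "bary i (v j) = (if i = j then 1 else 0)"
proof -
  have "bary 1 (v 1) = 1" "bary 2 (v 1) = 0" "bary 3 (v 1) = 0"
    using bary_eqI[of "v 1" 1 0 0] by simp_all
  moreover have "bary 1 (v 2) = 0" "bary 2 (v 2) = 1" "bary 3 (v 2) = 0"
    using bary_eqI[of "v 2" 0 1 0] by simp_all
  moreover have "bary 1 (v 3) = 0" "bary 2 (v 3) = 0" "bary 3 (v 3) = 1"
    using bary_eqI[of "v 3" 0 0 1] by simp_all
  ultimately show ?thesis
    using exhaust_3[of i] exhaust_3[of j] by (elim disjE) (simp_all only:, simp_all)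
qed

lemma continuous_on_bary: "continuous_on S (bary j)"
  unfolding bary_def Let_def using area_neq_0
  by (cases "j = 1"; cases "j = 2") (auto intro!: continuous_intros)

lemma w_vertex: "w j (v 2) = v j" "w j (v 3) = midpoint (v j) (v (j + 1))"
  "w j (v 1) = midpoint (v j) (v (j + 2))"
proof -
  have j: "j - 1 = j + 2" using exhaust_3[of j] by auto
  have "w j (v 1) = midpoint (v j) (v (j - 1))"
    using maps by (simp add: gasket_maps_def)
  then show "w j (v 1) = midpoint (v j) (v (j + 2))" unfolding j .
  show "w j (v 2) = v j" "w j (v 3) = midpoint (v j) (v (j + 1))"
    using maps by (simp_all add: gasket_maps_def)
qed

lemma dist_w: "dist (w j x) (w j y) = dist x y / 2"
  using maps by (auto simp: gasket_maps_def)

lemma continuous_on_w: "continuous_on S (w j)"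
proof (unfold continuous_on_iff, intro ballI allI impI)
  fix x and e :: real assume "e > 0"
  then show "\<exists>d>0. \<forall>x'\<in>S. dist x' x < d \<longrightarrow> dist (w j x') (w j x) < e"
    by (intro exI[of _ e]) (auto simp: dist_w)
qed

text \<open>An affine map preserves barycentric combinations, so the prescribed images of the
  vertices determine it.\<close>

lemma w_combination: "w j x = ((1 + bary 2 x) / 2) *\<^sub>R v j + (bary 3 x / 2) *\<^sub>R v (j + 1)
    + (bary 1 x / 2) *\<^sub>R v (j + 2)"
proof -
  define L where "L x = w j x - w j 0" for x
  have lin: "linear L" using maps unfolding gasket_maps_def L_def by blast
  have "L x = bary 1 x *\<^sub>R L (v 1) + bary 2 x *\<^sub>R L (v 2) + bary 3 x *\<^sub>R L (v 3)"
    by (subst bary_combination[of x]) (simp only: linear_add[OF lin] linear_cmul[OF lin])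
  then have "w j x = bary 1 x *\<^sub>R w j (v 1) + bary 2 x *\<^sub>R w j (v 2) + bary 3 x *\<^sub>R w j (v 3)
    + (1 - (bary 1 x + bary 2 x + bary 3 x)) *\<^sub>R w j 0"
    unfolding L_def by (simp add: algebra_simps)
  \<comment> \<open>\<open>v j\<close> receives all of the weight of \<open>v 2\<close> and half of
    the other two; the numerator is left unsimplified so that \<open>sum_bary\<close> turns it into
    \<open>1 + bary 2 x\<close>.\<close>
  also have "\<dots> = ((bary 1 x + bary 2 x + bary 3 x + bary 2 x) / 2) *\<^sub>R v j
    + (bary 3 x / 2) *\<^sub>R v (j + 1) + (bary 1 x / 2) *\<^sub>R v (j + 2)"
    unfolding sum_bary w_vertex
    by (subst sum_bary[of x, symmetric])
      (simp add: midpoint_def scaleR_add_left scaleR_add_right add_divide_distrib)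
  finally show ?thesis by (simp only: sum_bary)
qed

lemma three_add: "(1::3) + 1 = 2" "(2::3) + 1 = 3" "(3::3) + 1 = 1"
  "(1::3) + 2 = 3" "(2::3) + 2 = 1" "(3::3) + 2 = 2"
  by simp_all

text \<open>Each map halves the coordinates, moves the places 2, 3, 1 to j, j + 1, j + 2 and adds
  1/2 at j. The facts about codes below are read off from these formulas.\<close>

lemma bary_w: "bary j (w j x) = (1 + bary 2 x) / 2" "bary (j + 1) (w j x) = bary 3 x / 2"
  "bary (j + 2) (w j x) = bary 1 x / 2"
proof -
  have s: "bary 3 x = 1 - bary 1 x - bary 2 x" using sum_bary[of x] by simp
  consider "j = 1" | "j = 2" | "j = 3" using exhaust_3[of j] by blast
  then have "bary j (w j x) = (1 + bary 2 x) / 2 \<and> bary (j + 1) (w j x) = bary 3 x / 2 \<and>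
    bary (j + 2) (w j x) = bary 1 x / 2"
  proof cases
    case 1
    show ?thesis unfolding 1 three_add
      using bary_eqI[of "w 1 x" "(1 + bary 2 x) / 2" "bary 3 x / 2" "bary 1 x / 2"]
        w_combination[of 1 x] unfolding three_add by (simp add: s field_simps)
  next
    case 2
    show ?thesis unfolding 2 three_add
      using bary_eqI[of "w 2 x" "bary 1 x / 2" "(1 + bary 2 x) / 2" "bary 3 x / 2"]
        w_combination[of 2 x] unfolding three_add by (simp add: s field_simps)
  next
    case 3
    show ?thesis unfolding 3 three_add
      using bary_eqI[of "w 3 x" "bary 3 x / 2" "bary 1 x / 2" "(1 + bary 2 x) / 2"]
        w_combination[of 3 x] unfolding three_add by (simp add: s field_simps)
  qed
  then show "bary j (w j x) = (1 + bary 2 x) / 2" "bary (j + 1) (w j x) = bary 3 x / 2"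
    "bary (j + 2) (w j x) = bary 1 x / 2" by blast+
qed

lemma three_cases: "(i::3) = j \<or> i = j + 1 \<or> i = j + 2"
  using exhaust_3[of i] exhaust_3[of j] by auto

lemma compact_K: "compact K" and K_nonempty: "K \<noteq> {}" and K_eq: "K = (\<Union>j. w j ` K)"
  using gasket unfolding is_gasket_def by blast+

lemma w_in_K: "x \<in> K \<Longrightarrow> w j x \<in> K"
  by (subst K_eq) blast

text \<open>At a point of \<open>K\<close> minimizing a barycentric coordinate the minimum \<open>m\<close> satisfies
  \<open>m \<ge> m / 2\<close>.\<close>

lemma bary_nonneg:
  assumes "x \<in> K"
  shows "0 \<le> bary j x"
proof -
  define S where "S = (\<Union>j. bary j ` K)"
  have "compact S" unfolding S_def
    by (intro compact_UN) (auto intro!: compact_continuous_image continuous_on_bary compact_K)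
  moreover have "S \<noteq> {}" using K_nonempty by (auto simp: S_def)
  ultimately obtain m where m: "m \<in> S" "\<forall>t\<in>S. m \<le> t" using compact_attains_inf by blast
  then obtain i y where y: "y \<in> K" "m = bary i y" by (auto simp: S_def)
  then obtain l z where z: "z \<in> K" "y = w l z" using K_eq by blast
  have ge: "m \<le> bary k z" for k using m(2) z(1) by (auto simp: S_def)
  \<comment> \<open>For \<open>i = l\<close> the bound is even m \<ge> (1 + m) / 2.\<close>
  have "0 \<le> m"
    using three_cases[of i l] ge[of 1] ge[of 2] ge[of 3] y(2) z(2) bary_w[of l z] by auto
  moreover have "bary j x \<in> S" using assms by (auto simp: S_def)
  ultimately show ?thesis using m(2) by force
qed

lemma bary_le_1:
  assumes "x \<in> K"
  shows "bary j x \<le> 1"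
  using sum_bary[of x] bary_nonneg[OF assms, of 1] bary_nonneg[OF assms, of 2]
    bary_nonneg[OF assms, of 3] exhaust_3[of j]
  by (elim disjE) (hypsubst, linarith)+

section \<open>Cells and the coding map\<close>

lemma word_map_Nil [simp]: "word_map w [] x = x"
  by (simp add: word_map_def)

lemma word_map_Cons [simp]: "word_map w (j # u) x = w j (word_map w u x)"
  by (simp add: word_map_def)

lemma word_map_append: "word_map w (u @ u') x = word_map w u (word_map w u' x)"
  by (induction u) auto

lemma dist_word_map: "dist (word_map w u x) (word_map w u y) = dist x y / 2 ^ length u"
  by (induction u) (simp_all add: dist_w)

lemma continuous_on_word_map: "continuous_on S (word_map w u)"
proof (induction u)
  case Nil
  then show ?case by (simp add: word_map_def continuous_on_id)
next
  case (Cons j u)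
  have eq: "word_map w (j # u) = w j \<circ> word_map w u" by (simp add: fun_eq_iff)
  show ?case unfolding eq by (intro continuous_on_compose Cons continuous_on_w)
qed

lemma compact_cell: "compact (word_map w u ` K)"
  by (intro compact_continuous_image continuous_on_word_map compact_K)

abbreviation P :: "(nat \<Rightarrow> 3) \<Rightarrow> real^2" where
  "P \<equiv> coding_map w K"

lemma bound_K: obtains B where "B > 0" "\<And>x y. x \<in> K \<Longrightarrow> y \<in> K \<Longrightarrow> dist x y \<le> B"
proof -
  have "bounded K" using compact_K compact_imp_bounded by blast
  then have "dist x y \<le> diameter K + 1" if "x \<in> K" "y \<in> K" for x y
    using diameter_bounded_bound[OF _ that] by simp
  moreover have "diameter K + 1 > 0"
    using diameter_ge_0[OF \<open>bounded K\<close>] by simp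
  ultimately show thesis using that by blast
qed

lemma small_power_2:
  assumes "B > 0" "e > 0"
  obtains n where "B / 2 ^ n < (e::real)"
proof -
  obtain n where "(1/2) ^ n < e / B" using real_arch_pow_inv[of "e / B" "1/2"] assms by auto
  then show thesis using assms that[of n] by (simp add: field_simps)
qed

lemma cell_point_unique:
  assumes "\<And>n. x \<in> word_map w (map \<sigma> [0..<n]) ` K" "\<And>n. y \<in> word_map w (map \<sigma> [0..<n]) ` K"
  shows "x = y"
proof (rule ccontr)
  assume "x \<noteq> y"
  obtain B where B: "B > 0" "\<And>x y. x \<in> K \<Longrightarrow> y \<in> K \<Longrightarrow> dist x y \<le> B" by (rule bound_K) blast
  then obtain n where n: "B / 2 ^ n < dist x y"
    using small_power_2[of B "dist x y"] \<open>x \<noteq> y\<close> by auto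
  obtain x' y' where "x' \<in> K" "y' \<in> K"
    "x = word_map w (map \<sigma> [0..<n]) x'" "y = word_map w (map \<sigma> [0..<n]) y'"
    using assms[of n] by blast
  then have "dist x y \<le> B / 2 ^ n"
    using B by (simp add: dist_word_map divide_right_mono)
  then show False using n by simp
qed

lemma P_eqI: "(\<And>n. x \<in> word_map w (map \<sigma> [0..<n]) ` K) \<Longrightarrow> P \<sigma> = x"
  unfolding coding_map_def by (rule the_equality) (blast, rule cell_point_unique, blast+)

text \<open>Cantor's intersection theorem for the decreasing compact cells gives existence of the
  point that \<open>coding_map\<close> describes.\<close>

lemma P_in_cell: "P \<sigma> \<in> word_map w (map \<sigma> [0..<n]) ` K"
proof -
  let ?F = "\<lambda>n. word_map w (map \<sigma> [0..<n]) ` K"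
  have "?F n \<subseteq> ?F m" if "m \<le> n" for m n
    using that
  proof (induction rule: dec_induct)
    case (step n)
    have "?F (Suc n) \<subseteq> ?F n" by (auto simp: word_map_append intro!: w_in_K)
    then show ?case using step by blast
  qed simp
  then have "\<Inter> (range ?F) \<noteq> {}"
    by (intro compact_nest) (simp_all add: compact_cell K_nonempty)
  then obtain x where "\<And>n. x \<in> ?F n" by blast
  then show ?thesis using P_eqI[of x \<sigma>] by metis
qed

lemma P_in_K: "P \<sigma> \<in> K"
  using P_in_cell[of \<sigma> 0] by simp

lemma P_step: "P \<sigma> = w (\<sigma> 0) (P (\<lambda>n. \<sigma> (Suc n)))"
proof (rule P_eqI)
  fix n
  show "w (\<sigma> 0) (P (\<lambda>n. \<sigma> (Suc n))) \<in> word_map w (map \<sigma> [0..<n]) ` K"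
  proof (cases n)
    case (Suc m)
    have "map \<sigma> [0..<n] = \<sigma> 0 # map (\<lambda>n. \<sigma> (Suc n)) [0..<m]"
      unfolding Suc by (rule map_upt_Suc)
    then show ?thesis using P_in_cell[of "\<lambda>n. \<sigma> (Suc n)" m] by auto
  qed (simp add: w_in_K P_in_K)
qed

lemma P_prepend: "P (prepend u \<sigma>) = word_map w u (P \<sigma>)"
proof (induction u)
  case (Cons j u)
  then show ?case by (subst P_step) simp
qed simp

lemma P_surj:
  assumes "x \<in> K"
  obtains \<sigma> where "P \<sigma> = x"
proof -
  \<comment> \<open>A choice of letter and preimage for every point; iterating it from
    \<open>x\<close> yields an infinite code.\<close>
  have "\<forall>x\<in>K. \<exists>jy. snd jy \<in> K \<and> x = w (fst jy) (snd jy)"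
    using K_eq by force
  then obtain F where F: "\<And>x. x \<in> K \<Longrightarrow> snd (F x) \<in> K \<and> x = w (fst (F x)) (snd (F x))"
    by metis
  define X where "X n = ((snd \<circ> F) ^^ n) x" for n
  define \<sigma> where "\<sigma> n = fst (F (X n))" for n
  have X: "X n \<in> K" for n by (induction n) (auto simp: X_def assms F)
  have "x = word_map w (map \<sigma> [0..<n]) (X n)" for n
  proof (induction n)
    case (Suc n)
    have "X n = w (\<sigma> n) (X (Suc n))" using F[OF X[of n]] by (simp add: \<sigma>_def X_def)
    then show ?case using Suc by (simp add: word_map_append)
  qed (simp add: X_def)
  then have "P \<sigma> = x" using X by (intro P_eqI) blast
  then show thesis by (rule that)
qed

lemma dist_P:
  assumes "\<And>i. i < n \<Longrightarrow> \<sigma> i = \<tau> i" "\<And>x y. x \<in> K \<Longrightarrow> y \<in> K \<Longrightarrow> dist x y \<le> B"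
  shows "dist (P \<sigma>) (P \<tau>) \<le> B / 2 ^ n"
proof -
  have eq: "map \<sigma> [0..<n] = map \<tau> [0..<n]" using assms(1) by simp
  obtain x y where "x \<in> K" "y \<in> K" "P \<sigma> = word_map w (map \<tau> [0..<n]) x"
    "P \<tau> = word_map w (map \<tau> [0..<n]) y"
    using P_in_cell[of \<sigma> n, unfolded eq] P_in_cell[of \<tau> n] by blast
  then show ?thesis using assms(2) by (simp add: dist_word_map divide_right_mono)
qed

text \<open>The constant word 2 codes the fixed point of \<open>w 2\<close>, whose coordinates are
  forced to be those of \<open>v 2\<close>; then \<open>w j (v 2) = v j\<close> accounts for the
  letter \<open>j\<close>.\<close>

lemma P_vertex: "P (vertex_word (u @ [j])) = word_map w u (v j)"
proof -
  define x where "x = P (\<lambda>_. 2)"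
  have x: "x = w 2 x" unfolding x_def by (subst P_step) simp
  then have "bary 2 x = (1 + bary 2 x) / 2" "bary 3 x = bary 3 x / 2" "bary 1 x = bary 1 x / 2"
    using bary_w[of 2 x] unfolding three_add by simp_all
  then have "bary 1 x = 0" "bary 2 x = 1" "bary 3 x = 0" by auto
  then have "x = v 2" using bary_combination[of x] by simp
  then show ?thesis by (simp add: P_prepend word_map_append w_vertex x_def)
qed

text \<open>Both sides are the image under \<open>u\<close> of the midpoint of \<open>v j\<close>
  and \<open>v (j + 2)\<close>.\<close>

lemma P_glue: "P (vertex_word (u @ [j, 1])) = P (vertex_word (u @ [j + 2, 3]))"
proof -
  have j: "j + 2 + 1 = j" by simp
  have "P (vertex_word ((u @ [j]) @ [1])) = P (vertex_word ((u @ [j + 2]) @ [3]))"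
    unfolding P_vertex word_map_append word_map_Cons word_map_Nil w_vertex j
    by (simp only: midpoint_sym)
  then show ?thesis by simp
qed

text \<open>A coordinate d of a point of K is 1 only if the first letter is d and the remaining word
  has second coordinate 1. This condition then reproduces itself with d = 2, so outer vertices have
  unique codes.\<close>

lemma bary_P_eq_1:
  assumes "bary c (P \<sigma>) = 1"
  shows "\<sigma> = vertex_word [c]"
proof -
  have *: "\<tau> 0 = d \<and> bary 2 (P (\<lambda>n. \<tau> (Suc n))) = 1" if "bary d (P \<tau>) = 1" for d \<tau>
  proof -
    let ?y = "P (\<lambda>n. \<tau> (Suc n))"
    have eq: "bary d (w (\<tau> 0) ?y) = 1" using that P_step[of \<tau>] by simp
    have "bary 1 ?y \<le> 1" "bary 3 ?y \<le> 1" by (simp_all add: bary_le_1 P_in_K)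
    then show ?thesis
      using three_cases[of d "\<tau> 0"] eq bary_w[of "\<tau> 0" ?y] by auto
  qed
  have "bary 2 (P (\<lambda>i. \<sigma> (i + Suc n))) = 1" for n
  proof (induction n)
    case 0
    then show ?case using *[OF assms] by simp
  next
    case (Suc n)
    then show ?case using *[OF Suc] by simp
  qed
  from *[OF this] have "\<sigma> (Suc n) = 2" for n by simp
  then show ?thesis using *[OF assms] by (intro prepend_word_2) auto
qed

text \<open>Two cells of level one meet in a single point: comparing the coordinates
  \<open>\<sigma> 0\<close> and \<open>\<sigma> 0 + 1\<close> gives
  \<open>1 + bary 2 p = bary 1 q \<le> 1\<close> and \<open>bary 3 p = 1 + bary 2 q \<ge> 1\<close>,
  so the remaining words code outer vertices.\<close>

lemma P_eq_first_letter:
  assumes "P \<sigma> = P \<tau>" "\<tau> 0 = \<sigma> 0 + 1"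
  shows "\<sigma> = vertex_word [\<sigma> 0, 3]" "\<tau> = vertex_word [\<sigma> 0 + 1, 1]"
proof -
  let ?i = "\<sigma> 0"
  define p q where "p = P (\<lambda>n. \<sigma> (Suc n))" and "q = P (\<lambda>n. \<tau> (Suc n))"
  have pq: "p \<in> K" "q \<in> K" by (simp_all add: p_def q_def P_in_K)
  have eq: "w ?i p = w (?i + 1) q"
    using assms P_step[of \<sigma>] P_step[of \<tau>] by (simp add: p_def q_def)
  have i: "?i + 1 + 2 = ?i" by simp
  have "(1 + bary 2 p) / 2 = bary 1 q / 2" "bary 3 p / 2 = (1 + bary 2 q) / 2"
    using bary_w[of ?i p] bary_w[of "?i + 1" q] unfolding eq i by simp_all
  then have "bary 1 q = 1" "bary 3 p = 1"
    using bary_nonneg[OF pq(1), of 2] bary_nonneg[OF pq(2), of 2] bary_le_1[OF pq(1), of 3]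
      bary_le_1[OF pq(2), of 1] by auto
  then have "(\<lambda>n. \<sigma> (Suc n)) = vertex_word [3] \<and> (\<lambda>n. \<tau> (Suc n)) = vertex_word [1]"
    unfolding p_def q_def using bary_P_eq_1 by blast
  then have "\<sigma> (Suc n) = vertex_word [3] n" "\<tau> (Suc n) = vertex_word [1] n" for n
    by metis+
  then show "\<sigma> = vertex_word [\<sigma> 0, 3]" "\<tau> = vertex_word [\<sigma> 0 + 1, 1]"
    using assms(2) by (auto simp: fun_eq_iff prepend_def nth_Cons split: nat.split)
qed

text \<open>The longest common prefix can be removed because word maps are similitudes, hence
  injective. The next letters then differ by 1 modulo 3, in one order or the other.\<close>

lemma glued_factors:
  assumes g: "glued g" and eq: "P \<sigma> = P \<tau>"
  shows "g \<sigma> = g \<tau>"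
proof (cases "\<sigma> = \<tau>")
  case False
  then have "\<exists>n. \<sigma> n \<noteq> \<tau> n" by auto
  then obtain n where n: "\<sigma> n \<noteq> \<tau> n" "\<And>i. i < n \<Longrightarrow> \<sigma> i = \<tau> i"
    using exists_least_iff[of "\<lambda>n. \<sigma> n \<noteq> \<tau> n"] by blast
  define u where "u = map \<sigma> [0..<n]"
  define \<sigma>' \<tau>' where "\<sigma>' = (\<lambda>i. \<sigma> (i + n))" and "\<tau>' = (\<lambda>i. \<tau> (i + n))"
  have "map \<tau> [0..<n] = u" unfolding u_def using n(2) by simp
  then have st: "\<sigma> = prepend u \<sigma>'" "\<tau> = prepend u \<tau>'"
    using prepend_map_upt[of \<sigma> n] prepend_map_upt[of \<tau> n] unfolding u_def \<sigma>'_def \<tau>'_def by metis+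
  have "dist (P \<sigma>') (P \<tau>') / 2 ^ length u = 0"
    using eq unfolding st P_prepend by (simp flip: dist_word_map)
  then have eq': "P \<sigma>' = P \<tau>'" by simp
  have glue: "g (prepend u (vertex_word [i, 3])) = g (prepend u (vertex_word [i + 1, 1]))" for i
  proof -
    have "(i + 1) + 2 = i" by simp
    then show ?thesis
      using g[unfolded glued_def, rule_format, of u "i + 1"] by (simp only: prepend_append)
  qed
  have "\<sigma>' 0 \<noteq> \<tau>' 0" using n(1) by (simp add: \<sigma>'_def \<tau>'_def)
  then consider "\<tau>' 0 = \<sigma>' 0 + 1" | "\<sigma>' 0 = \<tau>' 0 + 1"
    using three_cases[of "\<tau>' 0" "\<sigma>' 0"] by (auto simp: add.assoc)
  then show ?thesis
  proof cases
    case 1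
    then show ?thesis using P_eq_first_letter[OF eq' 1] glue[of "\<sigma>' 0"] st by metis
  next
    case 2
    then show ?thesis using P_eq_first_letter[OF eq'[symmetric] 2] glue[of "\<tau>' 0"] st by metis
  qed
qed simp

section \<open>Functions on K as glued functions on words\<close>

lemma continuous_on_words_comp_P:
  assumes "continuous_on K f"
  shows "continuous_on_words (f \<circ> P)" "glued (f \<circ> P)"
proof -
  show "glued (f \<circ> P)" by (simp add: glued_def P_glue)
  show "continuous_on_words (f \<circ> P)"
    unfolding continuous_on_words_def
  proof (intro allI impI)
    fix e :: real assume "e > 0"
    then obtain d where d: "d > 0" "\<And>x y. x \<in> K \<Longrightarrow> y \<in> K \<Longrightarrow> dist y x < d \<Longrightarrow> dist (f y) (f x) < e"
      using compact_uniformly_continuous[OF assms compact_K]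
      unfolding uniformly_continuous_on_def by metis
    obtain B where B: "B > 0" "\<And>x y. x \<in> K \<Longrightarrow> y \<in> K \<Longrightarrow> dist x y \<le> B" by (rule bound_K) blast
    obtain n where n: "B / 2 ^ n < d" using small_power_2[OF B(1) d(1)] .
    show "\<exists>n. \<forall>\<sigma> \<tau>. (\<forall>i<n. \<sigma> i = \<tau> i) \<longrightarrow> cmod ((f \<circ> P) \<sigma> - (f \<circ> P) \<tau>) < e"
    proof (intro exI allI impI)
      fix \<sigma> \<tau> :: "nat \<Rightarrow> 3" assume "\<forall>i<n. \<sigma> i = \<tau> i"
      then have "dist (P \<sigma>) (P \<tau>) \<le> B / 2 ^ n" using B by (intro dist_P) auto
      then show "cmod ((f \<circ> P) \<sigma> - (f \<circ> P) \<tau>) < e"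
        using d(2)[of "P \<tau>" "P \<sigma>"] n by (simp add: P_in_K dist_norm)
    qed
  qed
qed

lemma ex_comp_P:
  assumes uc: "continuous_on_words g" and glued: "glued g"
  obtains f where "continuous_on K f" "g = f \<circ> P"
proof -
  define f where "f x = g (SOME \<sigma>. P \<sigma> = x)" for x
  have f: "f (P \<sigma>) = g \<sigma>" for \<sigma>
    unfolding f_def
    by (rule glued_factors[OF glued]) (rule someI[of "\<lambda>\<sigma>'. P \<sigma>' = P \<sigma>"], rule refl)
  have "continuous_on K f"
    unfolding continuous_on_iff
  proof (intro ballI allI impI)
    fix x and e :: real assume x: "x \<in> K" and e: "e > 0"
    obtain n where n: "\<And>\<sigma> \<tau>. \<forall>i<n. \<sigma> i = \<tau> i \<Longrightarrow> cmod (g \<sigma> - g \<tau>) < e"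
      using uc e unfolding continuous_on_words_def by blast
    \<comment> \<open>The finitely many cells of level n that miss x form a closed set. A point of K
      close to x therefore lies only in cells of level n that contain x, and shares with x a code
      prefix of length n.\<close>
    define U where "U = (\<Union>u\<in>{u \<in> words n. x \<notin> word_map w u ` K}. word_map w u ` K)"
    have "finite {u \<in> words n. x \<notin> word_map w u ` K}"
      by (rule finite_subset[of _ "words n"]) auto
    then have "closed U" unfolding U_def
      by (intro closed_UN) (auto intro: compact_imp_closed compact_cell)
    moreover have "x \<notin> U" by (auto simp: U_def)
    ultimately obtain d where d: "d > 0" "\<And>y. dist y x < d \<Longrightarrow> y \<notin> U"
      unfolding closed_def open_dist by auto
    show "\<exists>d>0. \<forall>y\<in>K. dist y x < d \<longrightarrow> dist (f y) (f x) < e"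
    proof (intro exI conjI ballI impI)
      fix y assume y: "y \<in> K" "dist y x < d"
      obtain \<tau> where \<tau>: "P \<tau> = y" using P_surj[OF y(1)] .
      define u where "u = map \<tau> [0..<n]"
      have "y \<in> word_map w u ` K" using P_in_cell[of \<tau> n] \<tau> by (simp add: u_def)
      moreover have "u \<in> words n" by (simp add: u_def)
      ultimately have "x \<in> word_map w u ` K" using d(2)[OF y(2)] by (auto simp: U_def)
      then obtain x' where x': "x' \<in> K" "x = word_map w u x'" by blast
      obtain \<rho> where "P \<rho> = x'" using P_surj[OF x'(1)] .
      then have "x = P (prepend u \<rho>)" by (simp add: P_prepend x'(2))
      moreover have "cmod (g \<tau> - g (prepend u \<rho>)) < e"
        by (rule n) (simp add: prepend_nth u_def)
      ultimately show "dist (f y) (f x) < e" using \<tau> f by (auto simp: dist_norm)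
    qed (rule d(1))
  qed
  moreover have "g = f \<circ> P" by (simp add: fun_eq_iff f)
  ultimately show thesis by (rule that)
qed

lemma C_gasket_eq: "C_gasket \<iota> w K = diag_embed \<iota> ` {g. continuous_on_words g \<and> glued g}"
proof -
  have "{f \<circ> P | f :: real^2 \<Rightarrow> complex. continuous_on K f} = {g. continuous_on_words g \<and> glued g}"
    using continuous_on_words_comp_P by (auto elim: ex_comp_P)
  moreover have "C_gasket \<iota> w K = diag_embed \<iota> ` {f \<circ> P | f. continuous_on K f}"
    unfolding C_gasket_def by blast
  ultimately show ?thesis by simp
qed

text \<open>The function is \<open>1\<close> on the cell of the word \<open>13\<close>, which contains none of the outer
  vertices: all barycentric coordinates are at most \<open>3/4\<close> there.\<close>

lemma ex_bump:
  obtains g :: "(nat \<Rightarrow> 3) \<Rightarrow> complex" where "continuous_on_words g" "glued g" "\<And>\<sigma>. cmod (g \<sigma>) \<le> 1"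
    "\<And>\<sigma>. \<sigma> 0 = 1 \<Longrightarrow> \<sigma> 1 = 3 \<Longrightarrow> g \<sigma> = 1" "\<And>j. g (vertex_word [j]) = 0"
proof -
  \<comment> \<open>The product is at least (1/4)^3 = 1/64 on the chosen cell, so the factor 64 and
    the cut-off make the function constant there; at each outer vertex one factor is 0.\<close>
  define h where "h x = min 1 (64 * ((1 - bary 1 x) * (1 - bary 2 x) * (1 - bary 3 x)))" for x
  define f where "f x = complex_of_real (h x)" for x
  have "continuous_on K f" unfolding f_def h_def
    by (intro continuous_intros continuous_on_bary)
  note cont = continuous_on_words_comp_P[OF this]
  have h01: "0 \<le> h x" "h x \<le> 1" if "x \<in> K" for x
    using bary_le_1[OF that] by (auto simp: h_def)
  have "cmod ((f \<circ> P) \<sigma>) \<le> 1" for \<sigma> using h01[OF P_in_K[of \<sigma>]] by (simp add: f_def)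
  moreover have "(f \<circ> P) \<sigma> = 1" if \<sigma>: "\<sigma> 0 = 1" "\<sigma> 1 = 3" for \<sigma>
  proof -
    define y where "y = P (\<lambda>n. \<sigma> (Suc (Suc n)))"
    have y: "y \<in> K" by (simp add: y_def P_in_K)
    have eq: "P \<sigma> = w 1 (w 3 y)"
      using P_step[of \<sigma>] P_step[of "\<lambda>n. \<sigma> (Suc n)"] \<sigma> by (simp add: y_def)
    have w3: "w 3 y \<in> K" by (simp add: w_in_K y)
    have "bary 2 (w 3 y) = bary 1 y / 2" using bary_w(3)[of 3 y] unfolding three_add .
    then have "bary 1 (P \<sigma>) \<le> 3/4"
      using bary_w(1)[of 1 "w 3 y"] bary_le_1[OF y, of 1] by (simp add: eq)
    moreover have "bary 2 (P \<sigma>) \<le> 3/4"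
      using bary_w(2)[of 1 "w 3 y"] bary_le_1[OF w3, of 3] unfolding three_add by (simp add: eq)
    moreover have "bary 3 (P \<sigma>) \<le> 3/4"
      using bary_w(3)[of 1 "w 3 y"] bary_le_1[OF w3, of 1] unfolding three_add by (simp add: eq)
    ultimately have "1/4 * (1/4) * (1/4) \<le>
      (1 - bary 1 (P \<sigma>)) * (1 - bary 2 (P \<sigma>)) * (1 - bary 3 (P \<sigma>))"
      by (intro mult_mono) auto
    then show ?thesis by (simp add: f_def h_def)
  qed
  moreover have "(f \<circ> P) (vertex_word [j]) = 0" for j
  proof -
    have "P (vertex_word [j]) = v j" using P_vertex[of "[]" j] by simp
    moreover have "h (v j) = 0"
      using exhaust_3[of j] by (elim disjE) (simp_all add: h_def bary_vertex)
    ultimately show ?thesis by (simp add: f_def)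
  qed
  ultimately show thesis by (rule that[OF cont])
qed

end

section \<open>Diagonal elements\<close>

lemma norm_mult_mult_le: "norm (x * y * z) \<le> norm x * norm y * norm (z::'a::real_normed_algebra)"
  by (rule order_trans[OF norm_mult_ineq mult_right_mono[OF norm_mult_ineq norm_ge_zero]])

context uhf_3_infinity
begin

lemma fin_alg_induct [consumes 1, case_names zero unit add scale]:
  assumes "b \<in> fin_alg n" "Q 0"
    and "\<And>\<sigma> \<tau>. length \<sigma> = n \<Longrightarrow> length \<tau> = n \<Longrightarrow> Q (E \<sigma> \<tau>)"
    and "\<And>x y. Q x \<Longrightarrow> Q y \<Longrightarrow> Q (x + y)" "\<And>c x. Q x \<Longrightarrow> Q (c *\<^sub>C x)"
  shows "Q b"
  using assms(1) unfolding fin_alg_def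
  by (rule complex_vector.span_induct) (use assms(2-) in \<open>auto intro!: complex_vector.subspaceI\<close>)

lemma subspace_fin_alg: "complex_vector.subspace (fin_alg n)"
  unfolding fin_alg_def by (rule complex_vector.subspace_span)

lemma E_in_fin_alg: "length \<sigma> = n \<Longrightarrow> length \<tau> = n \<Longrightarrow> E \<sigma> \<tau> \<in> fin_alg n"
  unfolding fin_alg_def by (intro complex_vector.span_base) blast

lemma fin_alg_mult:
  assumes "a \<in> fin_alg n" "b \<in> fin_alg n"
  shows "a * b \<in> fin_alg n"
  using assms(1)
proof (induction rule: fin_alg_induct)
  case (unit \<sigma> \<tau>)
  show ?case using assms(2)
  proof (induction rule: fin_alg_induct)
    case (unit \<sigma>' \<tau>')
    then show ?case using \<open>length \<sigma> = n\<close> \<open>length \<tau> = n\<close>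
      by (simp add: E_mult[of _ n] E_in_fin_alg complex_vector.subspace_0[OF subspace_fin_alg])
  qed (simp_all add: distrib_left mult_scaleC_right complex_vector.subspace_0[OF subspace_fin_alg]
      complex_vector.subspace_add[OF subspace_fin_alg]
      complex_vector.subspace_scale[OF subspace_fin_alg])
qed (simp_all add: distrib_right mult_scaleC_left complex_vector.subspace_0[OF subspace_fin_alg]
    complex_vector.subspace_add[OF subspace_fin_alg]
    complex_vector.subspace_scale[OF subspace_fin_alg])

definition D :: "nat \<Rightarrow> (3 list \<Rightarrow> complex) \<Rightarrow> 'u" where
  "D n c = (\<Sum>\<sigma>\<in>words n. c \<sigma> *\<^sub>C E \<sigma> \<sigma>)"

lemma D_cong: "(\<And>\<sigma>. length \<sigma> = n \<Longrightarrow> c \<sigma> = d \<sigma>) \<Longrightarrow> D n c = D n d"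
  unfolding D_def by (intro sum.cong) auto

lemma D_in_fin_alg: "D n c \<in> fin_alg n"
  unfolding D_def by (intro complex_vector.subspace_sum[OF subspace_fin_alg]
      complex_vector.subspace_scale[OF subspace_fin_alg] E_in_fin_alg) auto

lemma D_add: "D n c + D n d = D n (\<lambda>\<sigma>. c \<sigma> + d \<sigma>)"
  by (simp add: D_def scaleC_add_left sum.distrib)

lemma D_scale: "x *\<^sub>C D n c = D n (\<lambda>\<sigma>. x * c \<sigma>)"
  by (simp add: D_def complex_vector.scale_sum_right scaleC_scaleC)

lemma D_diff: "D n c - D n d = D n (\<lambda>\<sigma>. c \<sigma> - d \<sigma>)"
  by (simp add: D_def complex_vector.scale_left_diff_distrib sum_subtractf)

lemma D_const: "D n (\<lambda>_. x) = x *\<^sub>C 1"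
  by (simp add: D_def sum_E flip: complex_vector.scale_sum_right)

lemma star_D: "star (D n c) = D n (\<lambda>\<sigma>. cnj (c \<sigma>))"
  by (simp add: D_def star_sum star_scaleC star_E)

lemma D_mult_E: "length \<sigma> = n \<Longrightarrow> length \<tau> = n \<Longrightarrow> D n c * E \<sigma> \<tau> = c \<sigma> *\<^sub>C E \<sigma> \<tau>"
  by (simp add: D_def sum_distrib_right mult_scaleC_left E_mult[of _ n] if_distrib
      sum.delta cong: if_cong)

lemma E_mult_D: "length \<sigma> = n \<Longrightarrow> length \<tau> = n \<Longrightarrow> E \<sigma> \<tau> * D n c = c \<tau> *\<^sub>C E \<sigma> \<tau>"
  by (simp add: D_def sum_distrib_left mult_scaleC_right E_mult[of _ n] if_distrib
      sum.delta' cong: if_cong)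

lemma D_mult: "D n c * D n d = D n (\<lambda>\<sigma>. c \<sigma> * d \<sigma>)"
proof -
  have "D n c * D n d = (\<Sum>\<sigma>\<in>words n. d \<sigma> *\<^sub>C (D n c * E \<sigma> \<sigma>))"
    by (simp add: D_def[of n d] sum_distrib_left mult_scaleC_right)
  also have "\<dots> = D n (\<lambda>\<sigma>. c \<sigma> * d \<sigma>)"
    unfolding D_def[of n "\<lambda>\<sigma>. c \<sigma> * d \<sigma>"]
    by (intro sum.cong refl) (simp add: D_mult_E scaleC_scaleC mult.commute)
  finally show ?thesis .
qed

lemma D_refine:
  assumes "n \<le> m"
  shows "D n c = D m (\<lambda>\<sigma>. c (take n \<sigma>))"
proof -
  obtain k where m: "m = n + k" using assms le_Suc_ex by blast
  have "(\<Sum>\<rho>\<in>words k. E (\<sigma> @ \<rho>) (\<sigma> @ \<rho>)) = E \<sigma> \<sigma>" for \<sigma>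
    by (rule E_append[symmetric]) simp
  then show ?thesis
    unfolding D_def m sum_words_append by (simp flip: complex_vector.scale_sum_right)
qed

text \<open>The diagonal matrix units are projections that cut \<open>D n c\<close> into scalar
  blocks. Together with \<open>norm_D_ge\<close> this makes the norm of \<open>D n c\<close> the
  supremum of the coefficients.\<close>

lemma norm_D_le:
  assumes "\<And>\<sigma>. length \<sigma> = n \<Longrightarrow> cmod (c \<sigma>) \<le> M"
  shows "norm (D n c) \<le> M"
proof (rule norm_le_by_blocks[where I = "words n" and p = "\<lambda>\<sigma>. E \<sigma> \<sigma>"])
  fix \<sigma> assume "\<sigma> \<in> words n"
  then have \<sigma>: "length \<sigma> = n" by simp
  show "E \<sigma> \<sigma> * E \<sigma> \<sigma> = E \<sigma> \<sigma>" "star (E \<sigma> \<sigma>) = E \<sigma> \<sigma>" by (simp_all add: E_mult star_E)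
  show "D n c * E \<sigma> \<sigma> = E \<sigma> \<sigma> * D n c" using \<sigma> by (simp add: D_mult_E E_mult_D)
  show "norm (D n c * E \<sigma> \<sigma>) \<le> M" using \<sigma> assms by (simp add: D_mult_E norm_scaleC)
qed (simp_all add: sum_E)

lemma norm_D_ge:
  assumes "length \<sigma> = n"
  shows "cmod (c \<sigma>) \<le> norm (D n c)"
proof -
  have "norm (D n c * E \<sigma> \<sigma>) \<le> norm (D n c) * norm (E \<sigma> \<sigma>)" by (rule norm_mult_ineq)
  then show ?thesis using assms by (simp add: D_mult_E norm_scaleC)
qed

text \<open>Comparison at the common level \<open>max n m\<close>; it controls the coefficient
  functions of a convergent sequence of diagonal elements whose levels vary.\<close>

lemma norm_D_diff_ge:
  "cmod (c (map \<rho> [0..<n]) - d (map \<rho> [0..<m])) \<le> norm (D n c - D m d)"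
proof -
  let ?k = "max n m"
  have "D n c - D m d = D ?k (\<lambda>\<sigma>. c (take n \<sigma>) - d (take m \<sigma>))"
    by (simp add: D_refine[of n ?k] D_refine[of m ?k] D_diff)
  moreover have "take n (map \<rho> [0..<?k]) = map \<rho> [0..<n]" "take m (map \<rho> [0..<?k]) = map \<rho> [0..<m]"
    by (simp_all add: take_map take_upt)
  ultimately show ?thesis
    using norm_D_ge[of "map \<rho> [0..<?k]" ?k "\<lambda>\<sigma>. c (take n \<sigma>) - d (take m \<sigma>)"] by simp
qed

section \<open>The embedding of functions on infinite words\<close>

lemma diag_embed_eq: "diag_embed \<iota> g = lim (\<lambda>n. D n (\<lambda>\<sigma>. g (extend_word \<sigma>)))"
  unfolding diag_embed_def D_def E_def kron_list_munit
  by (intro arg_cong[where f = lim] ext sum.cong) auto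

lemma D_tendsto_diag_embed:
  assumes "continuous_on_words g"
  shows "(\<lambda>n. D n (\<lambda>\<sigma>. g (extend_word \<sigma>))) \<longlonglongrightarrow> diag_embed \<iota> g"
proof -
  have "Cauchy (\<lambda>n. D n (\<lambda>\<sigma>. g (extend_word \<sigma>)))"
  proof (rule CauchyI', unfold dist_norm)
    fix e :: real assume "e > 0"
    then have "e / 2 > 0" by simp
    then obtain N where N: "\<And>\<sigma> \<tau>. \<forall>i<N. \<sigma> i = \<tau> i \<Longrightarrow> cmod (g \<sigma> - g \<tau>) < e / 2"
      using assms unfolding continuous_on_words_def by blast
    have "norm (D m (\<lambda>\<sigma>. g (extend_word \<sigma>)) - D n (\<lambda>\<sigma>. g (extend_word \<sigma>))) < e"
      if "m \<ge> N" "n > m" for m n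
    proof -
      have "norm (D n (\<lambda>\<sigma>. g (extend_word (take m \<sigma>)) - g (extend_word \<sigma>))) \<le> e / 2"
        using that by (intro norm_D_le less_imp_le N) (auto simp: extend_word_def)
      then show ?thesis using that \<open>e > 0\<close> by (simp add: D_refine[of m n] D_diff)
    qed
    then show "\<exists>M. \<forall>m\<ge>M. \<forall>n>m. norm (D m (\<lambda>\<sigma>. g (extend_word \<sigma>)) - D n (\<lambda>\<sigma>. g (extend_word \<sigma>))) < e"
      by blast
  qed
  then show ?thesis
    unfolding diag_embed_eq by (simp add: Cauchy_convergent_iff convergent_LIMSEQ_iff)
qed

lemma norm_D_diff_diag_embed_le:
  assumes uc: "continuous_on_words g"
    and le: "\<And>\<rho>. cmod (c (map \<rho> [0..<n]) - g \<rho>) \<le> e"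
  shows "norm (D n c - diag_embed \<iota> g) \<le> e"
proof (rule LIMSEQ_le_const2)
  show "(\<lambda>m. norm (D n c - D m (\<lambda>\<sigma>. g (extend_word \<sigma>)))) \<longlonglongrightarrow> norm (D n c - diag_embed \<iota> g)"
    by (intro tendsto_intros D_tendsto_diag_embed uc)
  show "\<exists>N. \<forall>m\<ge>N. norm (D n c - D m (\<lambda>\<sigma>. g (extend_word \<sigma>))) \<le> e"
  proof (intro exI allI impI)
    fix m assume "n \<le> m"
    have "cmod (c (take n \<sigma>) - g (extend_word \<sigma>)) \<le> e" if "length \<sigma> = m" for \<sigma>
    proof -
      have "take n \<sigma> = map (extend_word \<sigma>) [0..<n]"
        using that \<open>n \<le> m\<close> by (auto intro!: nth_equalityI simp: extend_word_def)
      then show ?thesis using le[of "extend_word \<sigma>"] by simp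
    qed
    then show "norm (D n c - D m (\<lambda>\<sigma>. g (extend_word \<sigma>))) \<le> e"
      unfolding D_refine[OF \<open>n \<le> m\<close>] D_diff by (rule norm_D_le)
  qed
qed

lemma diag_embed_cylinder:
  assumes "continuous_on_words g" "\<And>\<rho>. g \<rho> = c (map \<rho> [0..<n])"
  shows "diag_embed \<iota> g = D n c"
  using norm_D_diff_diag_embed_le[of g c n 0] assms by simp

text \<open>The definition extends words by 1s, but uniform continuity allows any tail. The tail of
  2s will be the useful one: it samples g at the words to which the gluing condition refers.\<close>

lemma D_prepend_tendsto:
  assumes uc: "continuous_on_words g"
  shows "(\<lambda>n. D n (\<lambda>\<sigma>. g (prepend \<sigma> \<rho>))) \<longlonglongrightarrow> diag_embed \<iota> g"
proof (rule LIMSEQ_I)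
  fix e :: real assume "e > 0"
  then have "e / 2 > 0" by simp
  then obtain N where N: "\<And>\<sigma> \<tau>. \<forall>i<N. \<sigma> i = \<tau> i \<Longrightarrow> cmod (g \<sigma> - g \<tau>) < e / 2"
    using assms unfolding continuous_on_words_def by blast
  have "norm (D n (\<lambda>\<sigma>. g (prepend \<sigma> \<rho>)) - diag_embed \<iota> g) \<le> e / 2" if "n \<ge> N" for n
    using that by (intro norm_D_diff_diag_embed_le uc less_imp_le N) (auto simp: prepend_def)
  then show "\<exists>N. \<forall>n\<ge>N. norm (D n (\<lambda>\<sigma>. g (prepend \<sigma> \<rho>)) - diag_embed \<iota> g) < e"
    using \<open>e > 0\<close> by (intro exI[of _ N]) fastforce
qed

lemma diag_embed_mult:
  assumes "continuous_on_words g" "continuous_on_words h"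
  shows "diag_embed \<iota> (\<lambda>\<sigma>. g \<sigma> * h \<sigma>) = diag_embed \<iota> g * diag_embed \<iota> h"
  unfolding diag_embed_eq[of "\<lambda>\<sigma>. g \<sigma> * h \<sigma>"] D_mult[symmetric]
  by (intro limI tendsto_mult D_tendsto_diag_embed assms)

lemma diag_embed_add:
  assumes "continuous_on_words g" "continuous_on_words h"
  shows "diag_embed \<iota> (\<lambda>\<sigma>. g \<sigma> + h \<sigma>) = diag_embed \<iota> g + diag_embed \<iota> h"
  unfolding diag_embed_eq[of "\<lambda>\<sigma>. g \<sigma> + h \<sigma>"] D_add[symmetric]
  by (intro limI tendsto_add D_tendsto_diag_embed assms)

lemma diag_embed_scale:
  assumes "continuous_on_words g"
  shows "diag_embed \<iota> (\<lambda>\<sigma>. x * g \<sigma>) = x *\<^sub>C diag_embed \<iota> g"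
  unfolding diag_embed_eq[of "\<lambda>\<sigma>. x * g \<sigma>"] D_scale[symmetric]
  by (intro limI tendsto_scaleC D_tendsto_diag_embed assms)

lemma diag_embed_cnj:
  assumes "continuous_on_words g"
  shows "diag_embed \<iota> (\<lambda>\<sigma>. cnj (g \<sigma>)) = star (diag_embed \<iota> g)"
  unfolding diag_embed_eq[of "\<lambda>\<sigma>. cnj (g \<sigma>)"] star_D[symmetric]
  by (intro limI tendsto_star D_tendsto_diag_embed assms)

text \<open>The limit is \<open>diag_embed \<iota> g\<close> for the pointwise limit \<open>g\<close> of the coefficient functions of the
  approximating diagonal elements.\<close>

lemma limit_of_diagonals:
  assumes approx: "\<And>e. e > 0 \<Longrightarrow> \<exists>n c. norm (a - D n c) < e"
  obtains g where "continuous_on_words g" "a = diag_embed \<iota> g"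
proof -
  define r where "r k = 1 / real (Suc k)" for k
  have r: "r k > 0" for k by (simp add: r_def)
  have r0: "r \<longlonglongrightarrow> 0" unfolding r_def by (rule LIMSEQ_Suc) (rule lim_1_over_n)
  obtain n c where nc: "\<And>k. norm (a - D (n k) (c k)) < r k"
    using approx[OF r] by metis
  define G where "G k \<rho> = c k (map \<rho> [0..<n k])" for k \<rho>
  have G: "cmod (G k \<rho> - G l \<rho>) \<le> r k + r l" for k l \<rho>
  proof -
    have "cmod (G k \<rho> - G l \<rho>) \<le> norm (D (n k) (c k) - D (n l) (c l))"
      unfolding G_def by (rule norm_D_diff_ge)
    also have "\<dots> = norm ((a - D (n l) (c l)) - (a - D (n k) (c k)))" by (simp add: algebra_simps)
    also have "\<dots> \<le> norm (a - D (n l) (c l)) + norm (a - D (n k) (c k))" by (rule norm_triangle_ineq4)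
    finally show ?thesis using nc[of k] nc[of l] by simp
  qed
  have "convergent (\<lambda>k. G k \<rho>)" for \<rho>
  proof -
    have "Cauchy (\<lambda>k. G k \<rho>)"
    proof (rule metric_CauchyI)
      fix e :: real assume "e > 0"
      then have "eventually (\<lambda>k. r k < e / 2) sequentially"
        by (intro order_tendstoD(2)[OF r0]) simp
      then obtain M where M: "\<And>k. k \<ge> M \<Longrightarrow> r k < e / 2" by (auto simp: eventually_sequentially)
      have "dist (G k \<rho>) (G l \<rho>) < e" if "k \<ge> M" "l \<ge> M" for k l
        using G[of k \<rho> l] M[OF that(1)] M[OF that(2)] by (simp add: dist_norm)
      then show "\<exists>M. \<forall>k\<ge>M. \<forall>l\<ge>M. dist (G k \<rho>) (G l \<rho>) < e" by blast
    qed
    then show ?thesis by (rule Cauchy_convergent)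
  qed
  then obtain g where g: "\<And>\<rho>. (\<lambda>k. G k \<rho>) \<longlonglongrightarrow> g \<rho>"
    unfolding convergent_def by metis
  have Gg: "cmod (G k \<rho> - g \<rho>) \<le> r k" for k \<rho>
  proof (rule LIMSEQ_le)
    show "(\<lambda>l. cmod (G k \<rho> - G l \<rho>)) \<longlonglongrightarrow> cmod (G k \<rho> - g \<rho>)" by (intro tendsto_intros g)
    show "(\<lambda>l. r k + r l) \<longlonglongrightarrow> r k" using tendsto_add[OF tendsto_const[of "r k"] r0] by simp
    show "\<exists>N. \<forall>l\<ge>N. cmod (G k \<rho> - G l \<rho>) \<le> r k + r l" using G by blast
  qed
  have uc: "continuous_on_words g"
    unfolding continuous_on_words_def
  proof (intro allI impI)
    fix e :: real assume "e > 0"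
    then have "eventually (\<lambda>k. r k < e / 2) sequentially"
      by (intro order_tendstoD(2)[OF r0]) simp
    then obtain k where k: "r k < e / 2" by (auto simp: eventually_sequentially)
    have "cmod (g \<sigma> - g \<tau>) < e" if "\<forall>i<n k. \<sigma> i = \<tau> i" for \<sigma> \<tau>
    proof -
      have "map \<sigma> [0..<n k] = map \<tau> [0..<n k]" using that by simp
      then have "G k \<sigma> = G k \<tau>" by (simp only: G_def)
      then have "g \<sigma> - g \<tau> = (G k \<tau> - g \<tau>) - (G k \<sigma> - g \<sigma>)" by simp
      then have "cmod (g \<sigma> - g \<tau>) \<le> r k + r k"
        using norm_triangle_ineq4[of "G k \<tau> - g \<tau>" "G k \<sigma> - g \<sigma>"] Gg[of k \<tau>] Gg[of k \<sigma>] by simp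
      then show ?thesis using k by simp
    qed
    then show "\<exists>n. \<forall>\<sigma> \<tau>. (\<forall>i<n. \<sigma> i = \<tau> i) \<longrightarrow> cmod (g \<sigma> - g \<tau>) < e" by blast
  qed
  have "norm (a - diag_embed \<iota> g) \<le> r k + r k" for k
  proof -
    have "norm (D (n k) (c k) - diag_embed \<iota> g) \<le> r k"
      using Gg unfolding G_def by (intro norm_D_diff_diag_embed_le uc)
    then show ?thesis
      using norm_triangle_ineq[of "a - D (n k) (c k)" "D (n k) (c k) - diag_embed \<iota> g"] nc[of k]
      by simp
  qed
  then have "norm (a - diag_embed \<iota> g) \<le> 0"
    using tendsto_add[OF r0 r0] by (intro LIMSEQ_le_const[of "\<lambda>k. r k + r k"]) auto
  then show thesis using that[OF uc] by simp
qed

text \<open>Coefficients depend contractively on the element, so norm limits of diagonal elements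
  converge pointwise.\<close>

lemma norm_diag_embed_ge:
  assumes "continuous_on_words g" "continuous_on_words h"
  shows "cmod (g \<rho> - h \<rho>) \<le> norm (diag_embed \<iota> g - diag_embed \<iota> h)"
proof -
  let ?w = "\<lambda>n. extend_word (map \<rho> [0..<n])"
  have lim: "(\<lambda>n. k (?w n)) \<longlonglongrightarrow> k \<rho>" if "continuous_on_words k" for k
  proof (rule LIMSEQ_I)
    fix e :: real assume "e > 0"
    then obtain N where N: "\<And>\<sigma> \<tau>. \<forall>i<N. \<sigma> i = \<tau> i \<Longrightarrow> cmod (k \<sigma> - k \<tau>) < e"
      using \<open>continuous_on_words k\<close> unfolding continuous_on_words_def by blast
    have "norm (k (?w n) - k \<rho>) < e" if "n \<ge> N" for n
      using that by (intro N) (auto simp: extend_word_def)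
    then show "\<exists>N. \<forall>n\<ge>N. norm (k (?w n) - k \<rho>) < e" by blast
  qed
  show ?thesis
  proof (rule LIMSEQ_le)
    show "(\<lambda>n. cmod (g (?w n) - h (?w n))) \<longlonglongrightarrow> cmod (g \<rho> - h \<rho>)"
      by (intro tendsto_intros lim assms)
    show "(\<lambda>n. norm (D n (\<lambda>\<sigma>. g (extend_word \<sigma>)) - D n (\<lambda>\<sigma>. h (extend_word \<sigma>)))) \<longlonglongrightarrow>
        norm (diag_embed \<iota> g - diag_embed \<iota> h)"
      by (intro tendsto_intros D_tendsto_diag_embed assms)
    show "\<exists>N. \<forall>n\<ge>N. cmod (g (?w n) - h (?w n)) \<le>
        norm (D n (\<lambda>\<sigma>. g (extend_word \<sigma>)) - D n (\<lambda>\<sigma>. h (extend_word \<sigma>)))"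
      by (intro exI allI impI norm_D_diff_ge)
  qed
qed

section \<open>Commutants\<close>

text \<open>This is \<open>1 \<otimes> e\<^sub>\<theta>\<^sub>\<theta>\<^sub>'\<close> with \<open>1\<close> in the \<open>N\<close>-th tensor power.\<close>

definition W :: "nat \<Rightarrow> 3 list \<Rightarrow> 3 list \<Rightarrow> 'u" where
  "W N \<theta> \<theta>' = (\<Sum>\<pi>\<in>words N. E (\<pi> @ \<theta>) (\<pi> @ \<theta>'))"

text \<open>This is \<open>(T \<otimes> 1) (1 \<otimes> e) = T \<otimes> e\<close>, obtained by
  expanding the matrix unit T over suffixes of the length of \<theta>'.\<close>

lemma E_mult_W:
  assumes "length \<sigma> = N" "length \<tau> = N" "length \<theta> = length \<theta>'"
  shows "E \<sigma> \<tau> * W N \<theta> \<theta>' = E (\<sigma> @ \<theta>) (\<tau> @ \<theta>')"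
proof -
  let ?l = "length \<theta>'"
  have "E (\<sigma> @ \<rho>) (\<tau> @ \<rho>) * W N \<theta> \<theta>' = (if \<rho> = \<theta> then E (\<sigma> @ \<theta>) (\<tau> @ \<theta>') else 0)"
    if "length \<rho> = ?l" for \<rho>
  proof -
    have "E (\<sigma> @ \<rho>) (\<tau> @ \<rho>) * W N \<theta> \<theta>' =
        (\<Sum>\<pi>\<in>words N. if \<tau> = \<pi> then if \<rho> = \<theta> then E (\<sigma> @ \<theta>) (\<tau> @ \<theta>') else 0 else 0)"
      unfolding W_def sum_distrib_left
      by (intro sum.cong refl) (use that assms in \<open>auto simp: E_mult[of _ "N + ?l"]\<close>)
    then show ?thesis using assms by simp
  qed
  then have "(\<Sum>\<rho>\<in>words ?l. E (\<sigma> @ \<rho>) (\<tau> @ \<rho>) * W N \<theta> \<theta>') = E (\<sigma> @ \<theta>) (\<tau> @ \<theta>')"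
    using assms by simp
  then show ?thesis
    using E_append[of \<sigma> \<tau> ?l] assms by (simp add: sum_distrib_right)
qed

lemma star_W: "length \<theta> = length \<theta>' \<Longrightarrow> star (W N \<theta> \<theta>') = W N \<theta>' \<theta>"
  by (simp add: W_def star_sum star_E)

lemma W_mult_E:
  assumes "length \<sigma> = N" "length \<tau> = N" "length \<theta> = length \<theta>'"
  shows "W N \<theta> \<theta>' * E \<sigma> \<tau> = E (\<sigma> @ \<theta>) (\<tau> @ \<theta>')"
proof -
  have "star (W N \<theta> \<theta>' * E \<sigma> \<tau>) = star (E (\<sigma> @ \<theta>) (\<tau> @ \<theta>'))"
    using assms by (simp add: star_mult star_E star_W E_mult_W)
  then show ?thesis by (metis star_star)
qed

lemma W_commute:
  assumes "b \<in> fin_alg N" "length \<theta> = length \<theta>'"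
  shows "b * W N \<theta> \<theta>' = W N \<theta> \<theta>' * b"
  using assms(1)
  by (induction rule: fin_alg_induct)
    (simp_all add: E_mult_W W_mult_E assms(2) distrib_left distrib_right mult_scaleC_left
      mult_scaleC_right)

lemma W_mult:
  assumes "length \<theta> = length \<theta>'" "length \<theta>' = length \<theta>''"
  shows "W N \<theta> \<theta>' * W N \<theta>' \<theta>'' = W N \<theta> \<theta>''"
proof -
  have "E (\<pi> @ \<theta>) (\<pi> @ \<theta>') * W N \<theta>' \<theta>'' = E (\<pi> @ \<theta>) (\<pi> @ \<theta>'')" if "length \<pi> = N" for \<pi>
  proof -
    have "E (\<pi> @ \<theta>) (\<pi> @ \<theta>') * W N \<theta>' \<theta>'' =
        (\<Sum>\<rho>\<in>words N. if \<pi> = \<rho> then E (\<pi> @ \<theta>) (\<pi> @ \<theta>'') else 0)"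
      unfolding W_def sum_distrib_left
      by (intro sum.cong refl) (use that assms in \<open>auto simp: E_mult[of _ "N + length \<theta>"]\<close>)
    then show ?thesis using that by simp
  qed
  then show ?thesis by (simp add: W_def[of N \<theta>] sum_distrib_right)
qed

lemma sum_W: "(\<Sum>\<theta>\<in>words L. W N \<theta> \<theta>) = 1"
proof -
  have "(\<Sum>\<theta>\<in>words L. W N \<theta> \<theta>) = (\<Sum>\<sigma>\<in>words (N + L). E \<sigma> \<sigma>)"
    unfolding W_def sum_words_append by (rule sum.swap)
  then show ?thesis by (simp add: sum_E)
qed

lemma norm_W_le:
  assumes "length \<theta> = length \<theta>'"
  shows "norm (W N \<theta> \<theta>') \<le> 1"
proof -
  have "norm (W N \<theta>' \<theta>') \<le> 1"
    using norm_projection[of "W N \<theta>' \<theta>'"]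
    by (cases "W N \<theta>' \<theta>' = 0") (simp_all add: W_mult star_W)
  moreover have "(norm (W N \<theta> \<theta>'))\<^sup>2 = norm (W N \<theta>' \<theta>')"
    using assms by (simp add: star_W W_mult flip: norm_star_mult)
  ultimately have "(norm (W N \<theta> \<theta>'))\<^sup>2 \<le> 1\<^sup>2" by simp
  then show ?thesis by (rule power2_le_imp_le) simp
qed

text \<open>The blocks \<open>b (1 \<otimes> e\<^sub>\<theta>\<^sub>\<theta>)\<close> of \<open>b \<otimes> 1\<close> are pairwise unitarily equivalent.\<close>

lemma norm_le_norm_block:
  assumes b: "b \<in> fin_alg N"
  shows "norm b \<le> norm (b * W N \<theta> \<theta>)"
proof (rule norm_le_by_blocks[where I = "words (length \<theta>)" and p = "\<lambda>\<theta>. W N \<theta> \<theta>"])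
  fix \<theta>' assume "\<theta>' \<in> words (length \<theta>)"
  then have l: "length \<theta>' = length \<theta>" by simp
  show "W N \<theta>' \<theta>' * W N \<theta>' \<theta>' = W N \<theta>' \<theta>'" "star (W N \<theta>' \<theta>') = W N \<theta>' \<theta>'"
    "b * W N \<theta>' \<theta>' = W N \<theta>' \<theta>' * b"
    by (simp_all add: W_mult star_W W_commute b)
  have "W N \<theta>' \<theta> * (b * W N \<theta> \<theta>) * W N \<theta> \<theta>' = b * W N \<theta>' \<theta>'"
    using l by (metis W_commute[OF b] W_mult mult.assoc)
  then have "norm (b * W N \<theta>' \<theta>') \<le> norm (W N \<theta>' \<theta>) * norm (b * W N \<theta> \<theta>) * norm (W N \<theta> \<theta>')"
    using norm_mult_mult_le by metis
  also have "\<dots> \<le> 1 * norm (b * W N \<theta> \<theta>) * 1"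
    using l by (intro mult_mono norm_W_le) auto
  finally show "norm (b * W N \<theta>' \<theta>') \<le> norm (b * W N \<theta> \<theta>)" by simp
qed (simp_all add: sum_W)

lemma D_drop: "D (N + n) (\<lambda>\<sigma>. c (drop N \<sigma>)) = (\<Sum>\<rho>\<in>words n. c \<rho> *\<^sub>C W N \<rho> \<rho>)"
proof -
  have "D (N + n) (\<lambda>\<sigma>. c (drop N \<sigma>)) = (\<Sum>\<pi>\<in>words N. \<Sum>\<rho>\<in>words n. c \<rho> *\<^sub>C E (\<pi> @ \<rho>) (\<pi> @ \<rho>))"
    unfolding D_def sum_words_append by (intro sum.cong refl) simp
  also have "\<dots> = (\<Sum>\<rho>\<in>words n. c \<rho> *\<^sub>C W N \<rho> \<rho>)"
    unfolding W_def complex_vector.scale_sum_right by (rule sum.swap)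
  finally show ?thesis .
qed

section \<open>The elements \<open>1 \<otimes> g\<close>\<close>

lemma continuous_on_words_shift:
  assumes "continuous_on_words g"
  shows "continuous_on_words (\<lambda>\<sigma>. g (\<lambda>i. \<sigma> (i + N)))"
  unfolding continuous_on_words_def
proof (intro allI impI)
  fix e :: real assume "e > 0"
  then obtain n where n: "\<And>\<sigma> \<tau>. \<forall>i<n. \<sigma> i = \<tau> i \<Longrightarrow> cmod (g \<sigma> - g \<tau>) < e"
    using assms unfolding continuous_on_words_def by blast
  show "\<exists>n. \<forall>\<sigma> \<tau>. (\<forall>i<n. \<sigma> i = \<tau> i) \<longrightarrow> cmod (g (\<lambda>i. \<sigma> (i + N)) - g (\<lambda>i. \<tau> (i + N))) < e"
    by (intro exI[of _ "n + N"] allI impI n) simp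
qed

text \<open>This is \<open>1 \<otimes> g\<close> with 1 in the N-th tensor power: g reads the word
  after its first N letters.\<close>

definition shifted :: "((nat \<Rightarrow> 3) \<Rightarrow> complex) \<Rightarrow> nat \<Rightarrow> 'u" where
  "shifted g N = diag_embed \<iota> (\<lambda>\<sigma>. g (\<lambda>i. \<sigma> (i + N)))"

text \<open>Writes \<open>1 \<otimes> g\<close> as a limit of combinations of the
  \<open>W N \<rho> \<rho>\<close>, which commute with level N and have explicit products.\<close>

lemma shifted_tendsto:
  assumes "continuous_on_words g"
  shows "(\<lambda>n. \<Sum>\<rho>\<in>words n. g (prepend \<rho> \<tau>) *\<^sub>C W N \<rho> \<rho>) \<longlonglongrightarrow> shifted g N"
proof -
  have "(\<lambda>n. D (n + N) (\<lambda>\<sigma>. g (\<lambda>i. prepend \<sigma> \<tau> (i + N)))) \<longlonglongrightarrow> shifted g N"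
    unfolding shifted_def
    by (rule LIMSEQ_ignore_initial_segment)
      (rule D_prepend_tendsto[OF continuous_on_words_shift[OF assms]])
  moreover have "D (n + N) (\<lambda>\<sigma>. g (\<lambda>i. prepend \<sigma> \<tau> (i + N))) =
      (\<Sum>\<rho>\<in>words n. g (prepend \<rho> \<tau>) *\<^sub>C W N \<rho> \<rho>)" for n
  proof -
    have "D (N + n) (\<lambda>\<sigma>. g (\<lambda>i. prepend \<sigma> \<tau> (i + N))) = D (N + n) (\<lambda>\<sigma>. g (prepend (drop N \<sigma>) \<tau>))"
      by (intro D_cong arg_cong[where f = g]) (auto simp: prepend_def fun_eq_iff add.commute)
    then show ?thesis
      unfolding D_drop[where c = "\<lambda>\<rho>. g (prepend \<rho> \<tau>)"] by (simp only: add.commute)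
  qed
  ultimately show ?thesis by simp
qed

lemma shifted_commute:
  assumes "continuous_on_words g" "b \<in> fin_alg N"
  shows "b * shifted g N = shifted g N * b"
proof (rule LIMSEQ_unique)
  let ?s = "\<lambda>n. \<Sum>\<rho>\<in>words n. g (prepend \<rho> (\<lambda>_. 1)) *\<^sub>C W N \<rho> \<rho>"
  show "(\<lambda>n. b * ?s n) \<longlonglongrightarrow> b * shifted g N"
    by (intro tendsto_intros shifted_tendsto assms)
  have "b * ?s n = ?s n * b" for n
    by (simp add: sum_distrib_left sum_distrib_right mult_scaleC_left mult_scaleC_right
        W_commute[OF assms(2)])
  then show "(\<lambda>n. b * ?s n) \<longlonglongrightarrow> shifted g N * b"
    by (simp only:) (intro tendsto_intros shifted_tendsto assms)
qed

lemma norm_shifted_le: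
  assumes uc: "continuous_on_words g" and le: "\<And>\<sigma>. cmod (g \<sigma>) \<le> 1"
  shows "norm (shifted g N) \<le> 1"
  using norm_D_diff_diag_embed_le[OF continuous_on_words_shift[OF uc, of N],
      where c = "\<lambda>_. 0" and n = 0 and e = 1] le
  by (simp add: shifted_def D_const)

lemma W_mult_W_eq_0:
  assumes "length \<theta> = length \<theta>'" "\<theta> \<noteq> \<theta>'"
  shows "W N \<theta> \<theta> * W N \<theta>' \<theta>' = 0"
  unfolding W_def sum_distrib_left sum_distrib_right
  by (intro sum.neutral ballI) (use assms in \<open>auto simp: E_mult[of _ "N + length \<theta>'"]\<close>)

lemma W_split: "W N \<theta> \<theta> = (\<Sum>\<rho>\<in>words m. W N (\<theta> @ \<rho>) (\<theta> @ \<rho>))"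
proof -
  have "W N \<theta> \<theta> = (\<Sum>\<pi>\<in>words N. \<Sum>\<rho>\<in>words m. E (\<pi> @ \<theta> @ \<rho>) (\<pi> @ \<theta> @ \<rho>))"
    unfolding W_def
    by (intro sum.cong refl) (subst E_append[where m = m], simp_all)
  then show ?thesis unfolding W_def by (simp add: sum.swap[of _ "words m"])
qed

lemma shifted_mult_W:
  assumes uc: "continuous_on_words g" and g: "\<And>\<sigma>. g (prepend \<theta> \<sigma>) = 1"
  shows "shifted g N * W N \<theta> \<theta> = W N \<theta> \<theta>"
proof (rule LIMSEQ_unique)
  let ?s = "\<lambda>n. \<Sum>\<rho>\<in>words n. g (prepend \<rho> (\<lambda>_. 1)) *\<^sub>C W N \<rho> \<rho>"
  show "(\<lambda>n. ?s n * W N \<theta> \<theta>) \<longlonglongrightarrow> shifted g N * W N \<theta> \<theta>"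
    by (intro tendsto_intros shifted_tendsto uc)
  have "?s n * W N \<theta> \<theta> = W N \<theta> \<theta>" if n: "n \<ge> length \<theta>" for n
  proof -
    obtain m where m: "n = length \<theta> + m" using n le_Suc_ex by blast
    have "(g (prepend \<rho> (\<lambda>_. 1)) *\<^sub>C W N \<rho> \<rho>) * W N \<theta> \<theta> = W N \<rho> \<rho> * W N \<theta> \<theta>"
      if \<rho>: "length \<rho> = n" for \<rho>
    proof (cases "take (length \<theta>) \<rho> = \<theta>")
      case True
      then obtain \<rho>' where "\<rho> = \<theta> @ \<rho>'" by (metis append_take_drop_id)
      then show ?thesis by (simp add: prepend_append g)
    next
      case False
      \<comment> \<open>Every refinement of \<theta> to the length of \<rho> differs from \<rho>, so
        the projections are orthogonal.\<close>
      have "W N \<rho> \<rho> * W N \<theta> \<theta> = (\<Sum>\<rho>'\<in>words m. W N \<rho> \<rho> * W N (\<theta> @ \<rho>') (\<theta> @ \<rho>'))"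
        by (subst W_split[of N \<theta> m]) (simp add: sum_distrib_left)
      also have "\<dots> = 0"
        using False \<rho> m by (intro sum.neutral ballI W_mult_W_eq_0) auto
      finally show ?thesis by (simp add: mult_scaleC_left)
    qed
    then have "?s n * W N \<theta> \<theta> = (\<Sum>\<rho>\<in>words n. W N \<rho> \<rho>) * W N \<theta> \<theta>"
      unfolding sum_distrib_right by (intro sum.cong refl) simp
    then show ?thesis by (simp add: sum_W)
  qed
  then show "(\<lambda>n. ?s n * W N \<theta> \<theta>) \<longlonglongrightarrow> W N \<theta> \<theta>"
    by (intro tendsto_eventually) (auto simp: eventually_sequentially)
qed

text \<open>With X = [b, T] and Q = \<open>1 \<otimes> g\<close>, one block of X has the full norm
  of X, and Q acts as 1 on the block \<theta>, so the norm of X is at most that of X Q. Since Q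
  commutes with b and \<open>T * Q\<close> commutes with a, X Q = [b, T Q] = [b - a, T Q], which
  costs twice the error.\<close>

lemma commutator_bound:
  assumes uc: "continuous_on_words g" and le: "\<And>\<sigma>. cmod (g \<sigma>) \<le> 1"
    and g1: "\<And>\<sigma>. g (prepend \<theta> \<sigma>) = 1"
    and b: "b \<in> fin_alg N" "norm (a - b) \<le> e" and T: "T \<in> fin_alg N" "norm T \<le> 1"
    and comm: "a * (T * shifted g N) = T * shifted g N * a"
  shows "norm (b * T - T * b) \<le> 2 * e"
proof -
  let ?Q = "shifted g N" and ?W = "W N \<theta> \<theta>"
  have e: "0 \<le> e" using b(2) norm_ge_zero order_trans by blast
  have mem: "b * T - T * b \<in> fin_alg N"
    by (intro complex_vector.subspace_diff[OF subspace_fin_alg] fin_alg_mult b T)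
  have TQ: "norm (T * ?Q) \<le> 1"
    using norm_mult_ineq[of T ?Q] mult_le_one[OF T(2) norm_ge_zero norm_shifted_le[OF uc le, of N]]
    by linarith
  have "norm (b * T - T * b) \<le> norm ((b * T - T * b) * ?W)"
    by (rule norm_le_norm_block[OF mem])
  also have "(b * T - T * b) * ?W = (b * T - T * b) * ?Q * ?W"
    by (simp add: mult.assoc shifted_mult_W[OF uc g1])
  also have "norm \<dots> \<le> norm ((b * T - T * b) * ?Q) * 1"
    by (rule order_trans[OF norm_mult_ineq mult_left_mono[OF norm_W_le]]) auto
  also have "(b * T - T * b) * ?Q = b * (T * ?Q) - (T * ?Q) * b"
    by (simp add: algebra_simps shifted_commute[OF uc b(1)])
  also have "\<dots> = (T * ?Q) * (a - b) - (a - b) * (T * ?Q)"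
    using comm by (simp add: algebra_simps)
  also have "norm \<dots> \<le> norm ((T * ?Q) * (a - b)) + norm ((a - b) * (T * ?Q))"
    by (rule norm_triangle_ineq4)
  also have "\<dots> \<le> 1 * e + e * 1"
    by (intro add_mono order_trans[OF norm_mult_ineq] mult_mono TQ b) (use e in auto)
  finally show ?thesis by simp
qed

section \<open>Averaging over diagonal unitaries\<close>

definition unity_root :: "nat \<Rightarrow> 3 list \<Rightarrow> complex" where
  "unity_root n \<sigma> = cis (2 * pi * real (code \<sigma>) / real (3 ^ n))"

text \<open>Orthogonality of characters: the ratio is a \<open>3 ^ n\<close>-th root of unity, equal
  to 1 only for equal words, and otherwise the geometric sum vanishes.\<close>

lemma sum_unity_root_powers:
  assumes "length \<sigma> = n" "length \<tau> = n"
  shows "(\<Sum>k<3 ^ n. (unity_root n \<sigma> * cnj (unity_root n \<tau>)) ^ k) = (if \<sigma> = \<tau> then 3 ^ n else 0)"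
proof -
  let ?z = "unity_root n \<sigma> * cnj (unity_root n \<tau>)"
  have unit: "unity_root n \<rho> * cnj (unity_root n \<rho>) = 1" for \<rho>
    by (simp add: unity_root_def cis_mult cis_cnj)
  have pow: "unity_root n \<rho> ^ 3 ^ n = 1" for \<rho>
  proof -
    have "unity_root n \<rho> ^ 3 ^ n = cis (real (3 ^ n) * (2 * pi * real (code \<rho>) / real (3 ^ n)))"
      unfolding unity_root_def by (rule Complex.DeMoivre)
    also have "real (3 ^ n) * (2 * pi * real (code \<rho>) / real (3 ^ n)) = 2 * pi * real (code \<rho>)"
      by simp
    also have "cis \<dots> = 1" by (rule cis_multiple_2pi) simp
    finally show ?thesis .
  qed
  show ?thesis
  proof (cases "\<sigma> = \<tau>")
    case True
    then show ?thesis by (simp add: unit)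
  next
    case False
    have "?z \<noteq> 1"
    proof
      assume "?z = 1"
      have "?z * unity_root n \<tau> = unity_root n \<sigma> * (unity_root n \<tau> * cnj (unity_root n \<tau>))"
        by (simp only: ac_simps)
      then have eq: "unity_root n \<sigma> = unity_root n \<tau>" unfolding unit \<open>?z = 1\<close> by simp
      have inj: "inj_on (\<lambda>k. cis (2 * pi * real k / real (3 ^ n))) {..<3 ^ n}"
        using Complex.bij_betw_roots_unity[of "3 ^ n"] by (simp add: bij_betw_def)
      have "code \<sigma> = code \<tau>"
        by (rule inj_onD[OF inj])
          (use eq code_less[of \<sigma>] code_less[of \<tau>] assms in \<open>simp_all add: unity_root_def\<close>)
      then show False using False assms by (simp add: code_eq_iff)
    qed
    moreover have "?z ^ 3 ^ n = 1" by (simp add: power_mult_distrib pow flip: complex_cnj_power)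
    ultimately show ?thesis using False by (simp add: geometric_sum)
  qed
qed

text \<open>Conjugation by powers of a diagonal unitary with distinct roots of unity as coefficients
  averages to the conditional expectation onto the diagonal.\<close>

lemma diagonal_approximation:
  assumes b: "b \<in> fin_alg n"
    and comm: "\<And>c. (\<And>\<sigma>. cmod (c \<sigma>) = 1) \<Longrightarrow> norm (b * D n c - D n c * b) \<le> e"
  obtains d where "norm (b - D n d) \<le> e"
proof -
  define C where "C k = D n (\<lambda>\<sigma>. unity_root n \<sigma> ^ k)" for k
  define C' where "C' k = D n (\<lambda>\<sigma>. cnj (unity_root n \<sigma>) ^ k)" for k
  define avg where "avg x = (1 / 3 ^ n :: complex) *\<^sub>C (\<Sum>k<3 ^ n. C k * x * C' k)" for x
  have unit: "unity_root n \<rho> * cnj (unity_root n \<rho>) = 1" for \<rho>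
    by (simp add: unity_root_def cis_mult cis_cnj)
  have cmod: "cmod (unity_root n \<rho>) = 1" for \<rho> by (simp add: unity_root_def)
  have CC': "C k * C' k = 1" for k
    by (simp add: C_def C'_def D_mult unit D_const flip: power_mult_distrib)
  have "norm (C' k) \<le> 1" for k
    unfolding C'_def by (rule norm_D_le) (simp add: norm_power cmod)
  note C'_le = this
  have "norm (b - C k * b * C' k) \<le> e" for k
  proof -
    have e: "norm (b * C k - C k * b) \<le> e"
      unfolding C_def by (rule comm) (simp add: norm_power cmod)
    \<comment> \<open>Conjugation moves b only by a commutator times a contraction, so the average
      is as close to b as the commutators are small.\<close>
    have "b - C k * b * C' k = (b * C k - C k * b) * C' k"
      by (simp add: algebra_simps CC')
    then have "norm (b - C k * b * C' k) \<le> norm (b * C k - C k * b) * norm (C' k)"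
      by (simp only: norm_mult_ineq)
    also have "\<dots> \<le> e * 1"
      by (intro mult_mono e C'_le) (use e norm_ge_zero order_trans in blast)+
    finally show ?thesis by simp
  qed
  note le = this
  have "norm (b - avg b) \<le> e"
  proof -
    have "b = (1 / 3 ^ n :: complex) *\<^sub>C (3 ^ n :: complex) *\<^sub>C b" by (simp add: scaleC_scaleC)
    also have "(3 ^ n :: complex) *\<^sub>C b = (\<Sum>k<3 ^ n :: nat. b)"
      using scaleC_of_real[of "3 ^ n" b] by (simp add: sum_constant_scaleR del: sum_constant)
    finally have "b - avg b = (1 / 3 ^ n :: complex) *\<^sub>C (\<Sum>k<3 ^ n. b - C k * b * C' k)"
      by (simp only: avg_def sum_subtractf complex_vector.scale_right_diff_distrib)
    then have "norm (b - avg b) = (1 / 3 ^ n) * norm (\<Sum>k<3 ^ n. b - C k * b * C' k)"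
      by (simp add: norm_scaleC norm_divide norm_power)
    also have "\<dots> \<le> (1 / 3 ^ n) * (\<Sum>k<3 ^ n::nat. e)"
      by (intro mult_left_mono order_trans[OF norm_sum] sum_mono le) auto
    finally show ?thesis by simp
  qed
  moreover have "\<exists>d. avg b = D n d"
    using b
  proof (induction rule: fin_alg_induct)
    case zero
    have "avg 0 = D n (\<lambda>_. 0)" by (simp add: avg_def D_const)
    then show ?case by blast
  next
    case (unit \<sigma> \<tau>)
    \<comment> \<open>Matrix units are eigenvectors of the conjugation; the average keeps those with
      eigenvalue 1, which are the diagonal ones.\<close>
    have "C k * E \<sigma> \<tau> * C' k = ((unity_root n \<sigma> * cnj (unity_root n \<tau>)) ^ k) *\<^sub>C E \<sigma> \<tau>" for k
      using unit by (simp add: C_def C'_def D_mult_E E_mult_D mult_scaleC_left scaleC_scaleC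
          power_mult_distrib)
    then have "avg (E \<sigma> \<tau>) = (1 / 3 ^ n :: complex) *\<^sub>C
        (\<Sum>k<3 ^ n. (unity_root n \<sigma> * cnj (unity_root n \<tau>)) ^ k) *\<^sub>C E \<sigma> \<tau>"
      by (simp add: avg_def complex_vector.scale_sum_left)
    also have "\<dots> = (if \<sigma> = \<tau> then E \<sigma> \<sigma> else 0)"
      using unit by (simp add: sum_unity_root_powers scaleC_scaleC)
    also have "\<dots> = D n (\<lambda>\<rho>. if \<rho> = \<sigma> \<and> \<sigma> = \<tau> then 1 else 0)"
      using unit by (auto simp: D_def if_distrib[of "\<lambda>x. x *\<^sub>C _"] sum.delta cong: if_cong)
    finally show ?case by blast
  next
    case (add x y)
    have "avg (x + y) = avg x + avg y"
      by (simp add: avg_def distrib_left distrib_right sum.distrib scaleC_add_right)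
    then show ?case using add D_add by metis
  next
    case (scale c x)
    have "avg (c *\<^sub>C x) = c *\<^sub>C avg x"
      by (simp add: avg_def mult_scaleC_left mult_scaleC_right scaleC_scaleC mult.commute
          flip: complex_vector.scale_sum_right)
    then show ?case using scale D_scale by metis
  qed
  ultimately show thesis using that by metis
qed

lemma commuting_approximation:
  assumes uc: "continuous_on_words g" and le: "\<And>\<sigma>. cmod (g \<sigma>) \<le> 1"
    and g1: "\<And>\<sigma>. g (prepend \<theta> \<sigma>) = 1"
    and comm: "\<And>N \<sigma>. length \<sigma> = N \<Longrightarrow> a * (E \<sigma> \<sigma> * shifted g N) = E \<sigma> \<sigma> * shifted g N * a"
    and e: "e > 0"
  obtains n d where "norm (a - D n d) < e"
proof -
  \<comment> \<open>The commutator bound doubles the error to e / 2; adding the distance from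
    \<open>a\<close> to \<open>b\<close> leaves 3e / 4 < e.\<close>
  have "e / 4 > 0" using e by simp
  then obtain n b where b: "b \<in> fin_alg n" "norm (a - b) < e / 4" by (rule fin_alg_dense)
  have "norm (b * D n c - D n c * b) \<le> 2 * (e / 4)" if "\<And>\<sigma>. cmod (c \<sigma>) = 1" for c
  proof (rule commutator_bound[OF uc le g1 b(1)])
    show "norm (a - b) \<le> e / 4" using b by simp
    show "norm (D n c) \<le> 1" by (rule norm_D_le) (simp add: that)
    show "a * (D n c * shifted g n) = D n c * shifted g n * a"
      unfolding D_def sum_distrib_left sum_distrib_right
      by (intro sum.cong refl) (simp add: mult_scaleC_left mult_scaleC_right comm)
  qed (rule D_in_fin_alg)
  then obtain d where "norm (b - D n d) \<le> 2 * (e / 4)"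
    using diagonal_approximation[OF b(1)] by blast
  then have "norm (a - D n d) < e"
    using norm_triangle_ineq[of "a - b" "b - D n d"] b(2) e by simp
  then show thesis by (rule that)
qed

section \<open>The algebra of the gasket\<close>

text \<open>A word of length m + 1 is j 2^m or u j c 2^k with c = 1 or c = 3, and the bijection
  \<open>j \<mapsto> j + 2\<close> matches the words with c = 1 to those with c = 3. The induction
  strips a final letter 2.\<close>

lemma sum_words_in_subspace:
  assumes S: "complex_vector.subspace (S :: 'u set)"
  shows "(\<And>j. F (j # replicate m 2) \<in> S) \<Longrightarrow>
    (\<And>u j k. length u + k + 1 = m \<Longrightarrow>
      F (u @ j # 1 # replicate k 2) + F (u @ (j + 2) # 3 # replicate k 2) \<in> S) \<Longrightarrow>
    (\<Sum>\<rho>\<in>words (Suc m). F \<rho>) \<in> S"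
proof (induction m arbitrary: F)
  case 0
  have "(\<Sum>j\<in>UNIV. F [j]) \<in> S"
    using 0(1) by (intro complex_vector.subspace_sum[OF S]) simp
  then show ?case by (simp add: sum_words_1)
next
  case (Suc m)
  have "bij (\<lambda>j::3. j + 2)"
    by (rule o_bij[where g = "\<lambda>j. j - 2"]) (auto simp: fun_eq_iff)
  then have swap: "(\<Sum>j\<in>UNIV. F (u @ [j, 3])) = (\<Sum>j\<in>UNIV. F (u @ [j + 2, 3]))" for u
    by (rule sum.reindex_bij_betw[symmetric])
  have eq: "(\<Sum>\<rho>\<in>words (Suc m). F (\<rho> @ [1]) + F (\<rho> @ [3])) =
      (\<Sum>u\<in>words m. \<Sum>j\<in>UNIV. F (u @ [j, 1]) + F (u @ [j + 2, 3]))"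
    unfolding sum_words_snoc sum.distrib by (simp only: append_assoc append_Cons append_Nil swap)
  have "(\<Sum>\<rho>\<in>words (Suc m). F (\<rho> @ [1]) + F (\<rho> @ [3])) \<in> S"
    unfolding eq using Suc.prems(2)[where k = 0] by (intro complex_vector.subspace_sum[OF S]) simp
  moreover have "(\<Sum>\<rho>\<in>words (Suc m). F (\<rho> @ [2])) \<in> S"
  proof (rule Suc.IH)
    show "F ((j # replicate m 2) @ [2]) \<in> S" for j
      using Suc.prems(1)[of j] by (simp flip: replicate_append_same)
    show "F ((u @ j # 1 # replicate k 2) @ [2]) + F ((u @ (j + 2) # 3 # replicate k 2) @ [2]) \<in> S"
      if "length u + k + 1 = m" for u j k
      using Suc.prems(2)[of u "Suc k" j] that by (simp add: replicate_append_same)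
  qed
  ultimately have "(\<Sum>\<rho>\<in>words (Suc m). F (\<rho> @ [1]) + F (\<rho> @ [3])) +
      (\<Sum>\<rho>\<in>words (Suc m). F (\<rho> @ [2])) \<in> S"
    by (rule complex_vector.subspace_add[OF S])
  moreover have "(\<Sum>\<rho>\<in>words (Suc (Suc m)). F \<rho>) = (\<Sum>\<rho>\<in>words (Suc m). F (\<rho> @ [1]) + F (\<rho> @ [3])) +
      (\<Sum>\<rho>\<in>words (Suc m). F (\<rho> @ [2]))"
    by (simp only: sum_words_snoc[of F "Suc m"] sum_3 sum.distrib algebra_simps)
  ultimately show ?case by simp
qed

section \<open>Elements of A_\<infinity> built from glued functions\<close>

lemma vertex_word_replicate: "vertex_word (u @ replicate k 2) = vertex_word u"
  by (auto simp: prepend_def fun_eq_iff nth_append)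

lemma subspace_A_fin: "complex_vector.subspace (A_fin \<iota> n)"
  unfolding A_fin_def by (rule complex_vector.subspace_span)

text \<open>Sampled at vertex words, a glued g has equal coefficients on both words of each pair, so
  the pairs add up to multiples of the \<beta>-generators. The remaining words j 2^m give
  \<alpha>-generators if N = 0; for N > 0 no generator contains them alone, and g has to vanish
  there.\<close>

lemma E_mult_shifted_in_A_inf:
  assumes uc: "continuous_on_words g" and glued: "glued g"
    and len: "length \<sigma> = N" "length \<tau> = N" and zero: "N = 0 \<or> (\<forall>j. g (vertex_word [j]) = 0)"
  shows "E \<sigma> \<tau> * shifted g N \<in> A_inf \<iota>"
proof -
  define s where "s m = (\<Sum>\<rho>\<in>words (Suc m). g (vertex_word \<rho>) *\<^sub>C E (\<sigma> @ \<rho>) (\<tau> @ \<rho>))" for m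
  have A: "s m \<in> A_fin \<iota> (m + N)" for m
    unfolding s_def
  proof (rule sum_words_in_subspace[OF subspace_A_fin])
    fix j
    show "g (vertex_word (j # replicate m 2)) *\<^sub>C E (\<sigma> @ j # replicate m 2) (\<tau> @ j # replicate m 2)
        \<in> A_fin \<iota> (m + N)"
    proof (cases "N = 0")
      case True
      then show ?thesis
        using len
        by (simp add: A_fin_eq_span A_gens_vertex complex_vector.span_scale complex_vector.span_base)
    next
      case False
      then have "g (vertex_word (j # replicate m 2)) = 0"
        using zero vertex_word_replicate[of "[j]" m] by simp
      then show ?thesis by (simp add: complex_vector.subspace_0[OF subspace_A_fin])
    qed
  next
    fix u :: "3 list" and j k assume l: "length u + k + 1 = m"
    have vw: "vertex_word (u @ i # l # replicate k 2) = vertex_word (u @ [i, l])" for i l :: 3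
      using vertex_word_replicate[of "u @ [i, l]" k] by simp
    have eq: "g (vertex_word (u @ [j + 2, 3])) = g (vertex_word (u @ [j, 1]))"
      using glued by (simp only: glued_def)
    have "E ((\<sigma> @ u) @ j # 1 # replicate k 2) ((\<tau> @ u) @ j # 1 # replicate k 2) +
        E ((\<sigma> @ u) @ (j + 2) # 3 # replicate k 2) ((\<tau> @ u) @ (j + 2) # 3 # replicate k 2)
        \<in> A_gens (m + N)"
      using l len by (intro A_gens_pair) auto
    then have "g (vertex_word (u @ [j, 1])) *\<^sub>C
        (E ((\<sigma> @ u) @ j # 1 # replicate k 2) ((\<tau> @ u) @ j # 1 # replicate k 2) +
        E ((\<sigma> @ u) @ (j + 2) # 3 # replicate k 2) ((\<tau> @ u) @ (j + 2) # 3 # replicate k 2))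
        \<in> A_fin \<iota> (m + N)"
      unfolding A_fin_eq_span by (intro complex_vector.span_scale complex_vector.span_base)
    then show "g (vertex_word (u @ j # 1 # replicate k 2)) *\<^sub>C
          E (\<sigma> @ u @ j # 1 # replicate k 2) (\<tau> @ u @ j # 1 # replicate k 2) +
        g (vertex_word (u @ (j + 2) # 3 # replicate k 2)) *\<^sub>C
          E (\<sigma> @ u @ (j + 2) # 3 # replicate k 2) (\<tau> @ u @ (j + 2) # 3 # replicate k 2)
        \<in> A_fin \<iota> (m + N)"
      by (simp only: vw eq scaleC_add_right append_assoc)
  qed
  have s_eq: "s m = E \<sigma> \<tau> * (\<Sum>\<rho>\<in>words (Suc m). g (vertex_word \<rho>) *\<^sub>C W N \<rho> \<rho>)" for m
    unfolding s_def sum_distrib_left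
    by (intro sum.cong refl) (simp add: mult_scaleC_right E_mult_W len)
  have lim: "s \<longlonglongrightarrow> E \<sigma> \<tau> * shifted g N"
    unfolding s_eq by (intro tendsto_intros LIMSEQ_Suc shifted_tendsto uc)
  \<comment> \<open>\<open>s m\<close> lies in level \<open>m + N\<close>, while
    \<open>A_inf\<close> asks for a sequence with its n-th member in level n; the missing first N
    members are 0.\<close>
  define s' where "s' n = (if n < N then 0 else s (n - N))" for n
  have "s' n \<in> A_fin \<iota> n" for n
    using A[of "n - N"] by (auto simp: s'_def complex_vector.subspace_0[OF subspace_A_fin])
  moreover have "s' \<longlonglongrightarrow> E \<sigma> \<tau> * shifted g N"
    by (rule LIMSEQ_offset[of _ N]) (simp add: s'_def lim)
  ultimately show ?thesis unfolding A_inf_def by blast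
qed

lemma diag_embed_in_A_inf:
  assumes "continuous_on_words g" "glued g"
  shows "diag_embed \<iota> g \<in> A_inf \<iota>"
  using E_mult_shifted_in_A_inf[OF assms, of "[]" 0 "[]"] by (simp add: shifted_def)

section \<open>Diagonal elements of A_\<infinity> are glued\<close>

lemma last_non_2:
  assumes "u @ j # c # replicate k 2 = u' @ j' # c' # replicate k' 2" "c \<noteq> 2" "c' \<noteq> (2::3)"
  shows "u = u' \<and> j = j' \<and> c = c' \<and> k = k'"
proof -
  have r: "rev (u @ j # c # replicate k 2) = replicate k 2 @ c # j # rev u" for u j c k
    by simp
  have tw: "takeWhile (\<lambda>x. x = 2) (replicate k 2 @ c # v) = replicate k 2"
    if "c \<noteq> (2::3)" for k c v
    using that by (subst takeWhile_append2) auto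
  have eq: "replicate k 2 @ c # j # rev u = replicate k' 2 @ c' # j' # rev u'"
    using arg_cong[OF assms(1), of rev] unfolding r .
  then have "replicate k (2::3) = replicate k' 2"
    using tw[OF assms(2)] tw[OF assms(3)] by metis
  then have "k = k'" by (metis length_replicate)
  then show ?thesis using eq by simp
qed

lemma no_non_2:
  assumes "c \<noteq> (2::3)"
  shows "u @ j # c # replicate k 2 \<noteq> j' # replicate n 2"
proof
  assume *: "u @ j # c # replicate k 2 = j' # replicate n 2"
  have "c \<in> set (tl (u @ j # c # replicate k 2))" by (cases u) auto
  then have "c \<in> set (replicate n 2)" unfolding * by simp
  then show False using assms by (auto simp: set_replicate_conv_if split: if_splits)
qed

text \<open>The two words coding the same vertex give the same coefficient on the diagonal of an
  element of \<open>\<A>\<^sub>n\<close>; conjugation by the matrix unit between them makes this linear.\<close>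

lemma A_fin_twin:
  assumes x: "x \<in> A_fin \<iota> n" and n: "length u + k + 1 = n"
    and r: "r = u @ j # 1 # replicate k 2" and r': "r' = u @ (j + 2) # 3 # replicate k 2"
  shows "E r r * x * E r r = E r r' * x * E r' r"
  using x unfolding A_fin_eq_span
proof (induction rule: complex_vector.span_induct)
  case base
  show ?case
    by (rule complex_vector.subspaceI)
      (simp_all add: distrib_left distrib_right mult_scaleC_left mult_scaleC_right)
next
  case (step x)
  have ne: "(1::3) \<noteq> 2" "(3::3) \<noteq> 2" "(1::3) \<noteq> 3" by simp_all
  have len: "length r = Suc n" "length r' = Suc n" using n by (simp_all add: r r')
  \<comment> \<open>Conjugation picks out the single diagonal unit at \<rho>' and moves it to
    \<rho>.\<close>
  have mult: "E \<rho> \<rho>' * E p q * E \<rho>' \<rho> = (if \<rho>' = p \<and> q = \<rho>' then E \<rho> \<rho> else 0)"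
    if "length \<rho> = Suc n" "length \<rho>' = Suc n" "length p = Suc n" "length q = Suc n" for \<rho> \<rho>' p q
    using that by (simp add: E_mult[of _ "Suc n"])
  from step show ?case unfolding A_gens_def
  proof (elim UnE CollectE exE conjE)
    fix j' assume xeq: "x = E (j' # replicate n 2) (j' # replicate n 2)"
    have "r \<noteq> j' # replicate n 2" "r' \<noteq> j' # replicate n 2"
      unfolding r r' by (rule no_non_2, simp)+
    then show ?thesis unfolding xeq using len by (simp add: mult)
  next
    fix \<sigma> \<tau> j' k'
    assume xeq: "x = E (\<sigma> @ j' # 1 # replicate k' 2) (\<tau> @ j' # 1 # replicate k' 2) +
       E (\<sigma> @ (j' + 2) # 3 # replicate k' 2) (\<tau> @ (j' + 2) # 3 # replicate k' 2)"
      and l: "length \<sigma> + k' + 1 = n" "length \<tau> = length \<sigma>"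
    let ?p = "\<lambda>\<sigma>. \<sigma> @ j' # 1 # replicate k' 2" and ?p' = "\<lambda>\<sigma>. \<sigma> @ (j' + 2) # 3 # replicate k' 2"
    have iff: "r = ?p \<rho> \<longleftrightarrow> u = \<rho> \<and> j = j' \<and> k = k'" "r' = ?p' \<rho> \<longleftrightarrow> u = \<rho> \<and> j = j' \<and> k = k'" for \<rho>
      using last_non_2[OF _ ne(1,1), of u j k \<rho> j' k']
        last_non_2[OF _ ne(2,2), of u "j + 2" k \<rho> "j' + 2" k'] add_right_cancel[of j 2 j']
      unfolding r r' by fast+
    have neq: "r \<noteq> ?p' \<rho>" "r' \<noteq> ?p \<rho>" for \<rho>
      using last_non_2[OF _ ne(1,2), of u j k \<rho> "j' + 2" k']
        last_non_2[OF _ ne(2,1), of u "j + 2" k \<rho> j' k'] ne(3) ne(3)[symmetric] unfolding r r' by fast+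
    have lens: "length (?p \<sigma>) = Suc n" "length (?p \<tau>) = Suc n" "length (?p' \<sigma>) = Suc n"
      "length (?p' \<tau>) = Suc n" using l by simp_all
    have "E r r * x * E r r = (if r = ?p \<sigma> \<and> ?p \<tau> = r then E r r else 0)"
      unfolding xeq distrib_left distrib_right mult[OF len(1) len(1) lens(1,2)]
        mult[OF len(1) len(1) lens(3,4)] using neq by simp
    moreover have "E r r' * x * E r' r = (if r' = ?p' \<sigma> \<and> ?p' \<tau> = r' then E r r else 0)"
      unfolding xeq distrib_left distrib_right mult[OF len(1) len(2) lens(1,2)]
        mult[OF len(1) len(2) lens(3,4)] using neq by simp
    \<comment> \<open>A generator contains the diagonal unit at r exactly when it contains the one
      at r', because the last letter other than 2 determines the decomposition of a word.\<close>
    moreover have "(r = ?p \<sigma> \<and> ?p \<tau> = r) = (r' = ?p' \<sigma> \<and> ?p' \<tau> = r')"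
      using iff by metis
    ultimately show ?thesis by simp
  qed
qed

text \<open>The two compressions of \<open>A_fin_twin\<close> agree on approximants from A_n, while
  on diagonal approximants they read off the coefficients at the two words; the coefficients
  therefore differ by at most twice the distance of the approximants.\<close>

lemma glued_if_in_A_inf:
  assumes uc: "continuous_on_words g" and mem: "diag_embed \<iota> g \<in> A_inf \<iota>"
  shows "glued g"
  unfolding glued_def
proof (intro allI)
  fix u j
  obtain s where s: "\<And>n. s n \<in> A_fin \<iota> n" "s \<longlonglongrightarrow> diag_embed \<iota> g"
    using mem unfolding A_inf_def by blast
  \<comment> \<open>A_n lies in the tensor power n + 1, hence the level
    \<open>Suc n\<close>.\<close>
  define y where "y n = D (Suc n) (\<lambda>\<sigma>. g (vertex_word \<sigma>))" for n
  have "y \<longlonglongrightarrow> diag_embed \<iota> g"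
    unfolding y_def by (intro LIMSEQ_Suc D_prepend_tendsto uc)
  then have "(\<lambda>n. 2 * norm (y n - s n)) \<longlonglongrightarrow> 2 * norm (diag_embed \<iota> g - diag_embed \<iota> g)"
    by (intro tendsto_intros s)
  then have lim: "(\<lambda>n. 2 * norm (y n - s n)) \<longlonglongrightarrow> 0" by simp
  let ?d = "g (vertex_word (u @ [j, 1])) - g (vertex_word (u @ [j + 2, 3]))"
  have "cmod ?d \<le> 2 * norm (y n - s n)" if n: "n \<ge> length u + 1" for n
  proof -
    define k where "k = n - length u - 1"
    define r where "r = u @ j # 1 # replicate k 2"
    define r' where "r' = u @ (j + 2) # 3 # replicate k 2"
    have k: "length u + k + 1 = n" using n by (simp add: k_def)
    have len: "length r = Suc n" "length r' = Suc n" using k by (simp_all add: r_def r'_def)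
    have vw: "vertex_word r = vertex_word (u @ [j, 1])" "vertex_word r' = vertex_word (u @ [j + 2, 3])"
      using vertex_word_replicate[of "u @ [j, 1]" k] vertex_word_replicate[of "u @ [j + 2, 3]" k]
      by (simp_all add: r_def r'_def)
    let ?z = "y n - s n"
    have "E r r * y n * E r r = g (vertex_word r) *\<^sub>C E r r"
      "E r r' * y n * E r' r = g (vertex_word r') *\<^sub>C E r r"
      unfolding y_def using len by (simp_all add: E_mult_D mult_scaleC_left E_mult[of _ "Suc n"])
    moreover have "E r r * s n * E r r = E r r' * s n * E r' r"
      by (rule A_fin_twin[OF s(1) k r_def r'_def])
    ultimately have "?d *\<^sub>C E r r = E r r * ?z * E r r - E r r' * ?z * E r' r"
      by (simp add: vw left_diff_distrib right_diff_distrib complex_vector.scale_left_diff_distrib)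
    then have "cmod ?d = norm (E r r * ?z * E r r - E r r' * ?z * E r' r)"
      using norm_scaleC[of ?d "E r r"] by simp
    also have "\<dots> \<le> norm (E r r * ?z * E r r) + norm (E r r' * ?z * E r' r)"
      by (rule norm_triangle_ineq4)
    also have "\<dots> \<le> norm ?z + norm ?z"
      using norm_mult_mult_le[of "E r r" ?z "E r r"] norm_mult_mult_le[of "E r r'" ?z "E r' r"] len
      by simp
    finally show ?thesis by simp
  qed
  then have "cmod ?d \<le> 0" by (intro LIMSEQ_le_const[OF lim]) blast
  then show "g (vertex_word (u @ [j, 1])) = g (vertex_word (u @ [j + 2, 3]))" by simp
qed

text \<open>The commutator of \<open>D n d\<close> with \<open>E \<sigma> \<tau>\<close> is
  \<open>d \<sigma> - d \<tau>\<close> times that unit, so almost commuting with all units makes the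
  coefficients of a diagonal approximant almost constant.\<close>

lemma central_is_scalar:
  assumes uc: "continuous_on_words g" and le: "\<And>\<sigma>. cmod (g \<sigma>) \<le> 1"
    and g1: "\<And>\<sigma>. g (prepend \<theta> \<sigma>) = 1"
    and comm: "\<And>N \<sigma> \<tau>. length \<sigma> = N \<Longrightarrow> length \<tau> = N \<Longrightarrow>
      z * (E \<sigma> \<tau> * shifted g N) = E \<sigma> \<tau> * shifted g N * z"
  shows "z \<in> range (\<lambda>c. c *\<^sub>C 1)"
proof -
  have approx: "\<exists>c. norm (z - c *\<^sub>C 1) < e" if e: "e > 0" for e
  proof -
    have "e / 4 > 0" using e by simp
    then obtain n d where d: "norm (z - D n d) < e / 4"
      using commuting_approximation[OF uc le g1 comm] by metis
    define \<tau> :: "3 list" where "\<tau> = replicate n 1"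
    have "cmod (d \<sigma> - d \<tau>) \<le> 2 * (e / 4)" if \<sigma>: "length \<sigma> = n" for \<sigma>
    proof -
      have \<tau>: "length \<tau> = n" by (simp add: \<tau>_def)
      have "norm (D n d * E \<sigma> \<tau> - E \<sigma> \<tau> * D n d) \<le> 2 * (e / 4)"
        by (rule commutator_bound[where a = z, OF uc le g1 D_in_fin_alg _ E_in_fin_alg])
          (use d \<sigma> \<tau> comm in auto)
      then show ?thesis
        using \<sigma> \<tau> by (simp add: D_mult_E E_mult_D norm_scaleC
            flip: complex_vector.scale_left_diff_distrib)
    qed
    then have "norm (D n (\<lambda>\<sigma>. d \<sigma> - d \<tau>)) \<le> 2 * (e / 4)" by (rule norm_D_le)
    then have "norm (D n d - d \<tau> *\<^sub>C 1) \<le> 2 * (e / 4)" by (simp add: D_const flip: D_diff)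
    then have "norm (z - d \<tau> *\<^sub>C 1) < e"
      using norm_triangle_ineq[of "z - D n d" "D n d - d \<tau> *\<^sub>C 1"] d e by simp
    then show ?thesis by blast
  qed
  \<comment> \<open>The scalars are closed: \<open>c \<mapsto> c *\<^sub>C 1\<close> is isometric,
    so approximating scalars form a Cauchy sequence.\<close>
  obtain c where c: "\<And>k. norm (z - c k *\<^sub>C 1) < 1 / real (Suc k)"
    using approx[of "1 / real (Suc _)"] by (metis of_nat_0_less_iff zero_less_Suc zero_less_divide_1_iff)
  have lim: "(\<lambda>k. c k *\<^sub>C (1::'u)) \<longlonglongrightarrow> z"
  proof (rule LIM_zero_cancel, rule Lim_null_comparison)
    show "\<forall>\<^sub>F k in sequentially. norm (c k *\<^sub>C 1 - z) \<le> 1 / real (Suc k)"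
      using c by (auto simp: norm_minus_commute intro!: always_eventually less_imp_le)
  qed (rule LIMSEQ_Suc[OF lim_1_over_n])
  then have "Cauchy (\<lambda>k. c k *\<^sub>C (1::'u))" by (rule LIMSEQ_imp_Cauchy)
  then have "Cauchy c"
    unfolding Cauchy_def dist_norm
    by (simp add: norm_scaleC flip: complex_vector.scale_left_diff_distrib)
  then obtain x where "c \<longlonglongrightarrow> x" by (meson Cauchy_convergent convergent_def)
  then have "(\<lambda>k. norm (c k - x)) \<longlonglongrightarrow> 0" by (intro tendsto_norm_zero LIM_zero)
  then have "(\<lambda>k. norm (c k *\<^sub>C (1::'u) - x *\<^sub>C 1)) \<longlonglongrightarrow> 0"
    by (simp add: norm_scaleC flip: complex_vector.scale_left_diff_distrib)
  then have "(\<lambda>k. c k *\<^sub>C (1::'u)) \<longlonglongrightarrow> x *\<^sub>C 1"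
    by (rule LIM_zero_cancel[OF tendsto_norm_zero_cancel])
  then have "z = x *\<^sub>C 1" by (rule LIMSEQ_unique[OF lim])
  then show ?thesis by blast
qed

section \<open>Copies of a function on one cell, and closedness of C(K)\<close>

lemma shift_vertex_word: "(\<lambda>i. vertex_word u (i + N)) = vertex_word (drop N u)"
  by (auto simp: prepend_def fun_eq_iff add.commute)

text \<open>If the two words of a pair split after the first N letters, gluing of g itself applies.
  Otherwise at most the last letter before the tail of 2s survives the shift, and both values are
  values of g at outer vertices or 0.\<close>

lemma glued_cylinder_shift:
  assumes glued: "glued g" and zero: "\<And>j. g (vertex_word [j]) = 0"
  shows "glued (\<lambda>\<rho>. if map \<rho> [0..<N] = \<sigma> then g (\<lambda>i. \<rho> (i + N)) else 0)"
  unfolding glued_def shift_vertex_word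
proof (intro allI)
  fix u :: "3 list" and j :: 3
  show "(if map (vertex_word (u @ [j, 1])) [0..<N] = \<sigma> then g (vertex_word (drop N (u @ [j, 1]))) else 0)
    = (if map (vertex_word (u @ [j + 2, 3])) [0..<N] = \<sigma>
       then g (vertex_word (drop N (u @ [j + 2, 3]))) else 0)"
  proof (cases "N \<le> length u")
    case True
    have "map (vertex_word (u @ v)) [0..<N] = take N u" for v
      using True by (intro nth_equalityI) (auto simp: prepend_def nth_append)
    then show ?thesis using True glued by (simp add: glued_def)
  next
    case False
    \<comment> \<open>The empty word and the word 2 code the same outer vertex.\<close>
    have nil: "g (vertex_word []) = 0" using zero[of 2] vertex_word_append_2[of "[]"] by simp
    have "g (vertex_word (drop N (u @ [i, l]))) = 0" for i l
    proof -
      have "drop N (u @ [i, l]) = [l] \<or> drop N (u @ [i, l]) = []"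
        using False by (cases "N - length u") (auto simp: drop_Cons')
      then show ?thesis using zero nil by auto
    qed
    then show ?thesis by simp
  qed
qed

lemma E_mult_shifted_eq_diag_embed:
  assumes uc: "continuous_on_words g" and \<sigma>: "length \<sigma> = N"
  defines "h \<equiv> \<lambda>\<rho>. if map \<rho> [0..<N] = \<sigma> then g (\<lambda>i. \<rho> (i + N)) else 0"
  shows "E \<sigma> \<sigma> * shifted g N = diag_embed \<iota> h" "continuous_on_words h"
proof -
  let ?c = "\<lambda>\<tau>. if \<tau> = \<sigma> then 1 else (0::complex)"
  let ?k = "\<lambda>\<rho>. ?c (map \<rho> [0..<N])"
  have k_eq: "?k \<rho> = ?k \<tau>" if "\<forall>i<N. \<rho> i = \<tau> i" for \<rho> \<tau>
  proof -
    have "map \<rho> [0..<N] = map \<tau> [0..<N]" using that by simp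
    then show ?thesis by (simp only:)
  qed
  have uck: "continuous_on_words ?k"
    unfolding continuous_on_words_def
    by (intro allI impI exI[of _ N]) (subst k_eq, assumption, simp)
  have "E \<sigma> \<sigma> = D N ?c"
    using \<sigma> by (simp add: D_def if_distrib[of "\<lambda>x. x *\<^sub>C _"] sum.delta cong: if_cong)
  then have "E \<sigma> \<sigma> = diag_embed \<iota> ?k"
    by (simp only: diag_embed_cylinder[OF uck])
  moreover have h: "h = (\<lambda>\<rho>. ?k \<rho> * g (\<lambda>i. \<rho> (i + N)))" by (auto simp: h_def)
  ultimately show "E \<sigma> \<sigma> * shifted g N = diag_embed \<iota> h"
    unfolding shifted_def h
    by (simp only: diag_embed_mult[OF uck continuous_on_words_shift[OF uc]])
  show "continuous_on_words h"
    unfolding continuous_on_words_def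
  proof (intro allI impI)
    fix e :: real assume e: "e > 0"
    then obtain n where n: "\<And>\<sigma> \<tau>. \<forall>i<n. \<sigma> i = \<tau> i \<Longrightarrow> cmod (g (\<lambda>i. \<sigma> (i + N)) - g (\<lambda>i. \<tau> (i + N))) < e"
      using continuous_on_words_shift[OF uc, of N] unfolding continuous_on_words_def by blast
    have "cmod (h \<rho> - h \<tau>) < e" if "\<forall>i<max n N. \<rho> i = \<tau> i" for \<rho> \<tau>
    proof -
      have "?k \<rho> = ?k \<tau>" by (rule k_eq) (use that in simp)
      then have "h \<rho> - h \<tau> = ?k \<tau> * (g (\<lambda>i. \<rho> (i + N)) - g (\<lambda>i. \<tau> (i + N)))"
        unfolding h by (simp only: right_diff_distrib)
      moreover have "cmod (g (\<lambda>i. \<rho> (i + N)) - g (\<lambda>i. \<tau> (i + N))) < e"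
        by (rule n) (use that in simp)
      ultimately show ?thesis using e by simp
    qed
    then show "\<exists>n. \<forall>\<sigma> \<tau>. (\<forall>i<n. \<sigma> i = \<tau> i) \<longrightarrow> cmod (h \<sigma> - h \<tau>) < e" by blast
  qed
qed

lemma diag_embed_const: "diag_embed \<iota> (\<lambda>_. c) = c *\<^sub>C 1"
  using diag_embed_cylinder[of "\<lambda>_. c" "\<lambda>_. c" 0]
  by (simp add: continuous_on_words_def D_const)

text \<open>A limit is diagonal by \<open>limit_of_diagonals\<close>, and gluing survives because
  the coefficients converge pointwise.\<close>

lemma closed_diag_embed_glued: "closed (diag_embed \<iota> ` {g. continuous_on_words g \<and> glued g})"
  unfolding closed_sequential_limits
proof (intro allI impI, elim conjE)
  fix x l
  assume x: "\<forall>k. x k \<in> diag_embed \<iota> ` {g. continuous_on_words g \<and> glued g}" and lim: "x \<longlonglongrightarrow> l"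
  then have "\<forall>k. \<exists>g. continuous_on_words g \<and> glued g \<and> x k = diag_embed \<iota> g" by blast
  then obtain G where "\<forall>k. continuous_on_words (G k) \<and> glued (G k) \<and> x k = diag_embed \<iota> (G k)"
    by (rule choice[THEN exE])
  then have G: "\<And>k. continuous_on_words (G k)" "\<And>k. glued (G k)" "\<And>k. x k = diag_embed \<iota> (G k)"
    by blast+
  have "\<exists>n c. norm (l - D n c) < e" if "e > 0" for e
  proof -
    have e: "e / 2 > 0" using that by simp
    obtain k where k: "norm (x k - l) < e / 2" using LIMSEQ_D[OF lim e] by blast
    obtain n where "norm (D n (\<lambda>\<sigma>. G k (extend_word \<sigma>)) - x k) < e / 2"
      using LIMSEQ_D[OF D_tendsto_diag_embed[OF G(1)] e] G(3) by force
    then have "norm (l - D n (\<lambda>\<sigma>. G k (extend_word \<sigma>))) < e"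
      using k norm_triangle_ineq[of "l - x k" "x k - D n (\<lambda>\<sigma>. G k (extend_word \<sigma>))"]
      by (simp add: norm_minus_commute)
    then show ?thesis by blast
  qed
  then obtain g where g: "continuous_on_words g" "l = diag_embed \<iota> g"
    by (rule limit_of_diagonals)
  have pointwise: "(\<lambda>k. G k \<rho>) \<longlonglongrightarrow> g \<rho>" for \<rho>
  proof (rule LIM_zero_cancel, rule Lim_null_comparison)
    show "\<forall>\<^sub>F k in sequentially. norm (G k \<rho> - g \<rho>) \<le> norm (x k - l)"
      unfolding G(3) g(2) by (intro always_eventually allI norm_diag_embed_ge G(1) g(1))
    show "(\<lambda>k. norm (x k - l)) \<longlonglongrightarrow> 0"
      using lim by (simp add: LIM_zero tendsto_norm_zero)
  qed
  have "glued g"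
    unfolding glued_def
  proof (intro allI)
    fix u j
    have "G k (vertex_word (u @ [j, 1])) = G k (vertex_word (u @ [j + 2, 3]))" for k
      using G(2) unfolding glued_def by blast
    then show "g (vertex_word (u @ [j, 1])) = g (vertex_word (u @ [j + 2, 3]))"
      using pointwise[of "vertex_word (u @ [j, 1])"] pointwise[of "vertex_word (u @ [j + 2, 3])"]
      by (simp only:) (rule LIMSEQ_unique)
  qed
  then show "l \<in> diag_embed \<iota> ` {g. continuous_on_words g \<and> glued g}" using g by blast
qed

end

section \<open>C(K) as a C*-subalgebra\<close>

context gasket
begin

text \<open>Passing to functions on K treats sums, products, scalar multiples and conjugates at
  once.\<close>

lemma continuous_glued_map2:
  assumes F: "continuous_on UNIV (\<lambda>(x, y). F x y)"
    and g: "continuous_on_words g" "glued g" and h: "continuous_on_words h" "glued h"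
  shows "(\<lambda>\<sigma>. F (g \<sigma>) (h \<sigma>)) \<in> {g. continuous_on_words g \<and> glued g}"
proof -
  obtain f where f: "continuous_on K f" "g = f \<circ> P" by (rule ex_comp_P[OF g])
  obtain f' where f': "continuous_on K f'" "h = f' \<circ> P" by (rule ex_comp_P[OF h])
  have "continuous_on K (\<lambda>x. F (f x) (f' x))"
    using continuous_on_compose2[OF F continuous_on_Pair[OF f(1) f'(1)]] by simp
  from continuous_on_words_comp_P[OF this]
  show ?thesis by (simp add: f(2) f'(2) comp_def)
qed

lemma cstar_subalgebra_C_gasket:
  assumes "uhf_3_infinity \<iota>"
  shows "cstar_subalgebra (C_gasket \<iota> w K)"
proof -
  interpret uhf_3_infinity \<iota> by fact
  let ?S = "{g. continuous_on_words g \<and> glued g}"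
  have const: "(\<lambda>_. c) \<in> ?S" for c by (simp add: continuous_on_words_def glued_def)
  show ?thesis
    unfolding cstar_subalgebra_def C_gasket_eq
  proof (intro conjI ballI complex_vector.subspaceI closed_diag_embed_glued)
    show "0 \<in> diag_embed \<iota> ` ?S"
      using const[of 0] diag_embed_const[of 0] by (intro image_eqI[of _ _ "\<lambda>_. 0"]) simp_all
  next
    fix x y assume "x \<in> diag_embed \<iota> ` ?S" "y \<in> diag_embed \<iota> ` ?S"
    then obtain g h where g: "continuous_on_words g" "glued g" "x = diag_embed \<iota> g"
      and h: "continuous_on_words h" "glued h" "y = diag_embed \<iota> h" by blast
    have "continuous_on UNIV (\<lambda>(x, y). x + y :: complex)" "continuous_on UNIV (\<lambda>(x, y). x * y :: complex)"
      by (auto simp: case_prod_unfold intro!: continuous_intros)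
    from this[THEN continuous_glued_map2, OF g(1,2) h(1,2)]
    show "x + y \<in> diag_embed \<iota> ` ?S" "x * y \<in> diag_embed \<iota> ` ?S"
      unfolding g(3) h(3) diag_embed_add[OF g(1) h(1), symmetric]
        diag_embed_mult[OF g(1) h(1), symmetric] by - (rule imageI, assumption)+
  next
    fix c :: complex and x assume "x \<in> diag_embed \<iota> ` ?S"
    then obtain g where g: "continuous_on_words g" "glued g" "x = diag_embed \<iota> g" by blast
    \<comment> \<open>Unary operations as binary ones that ignore the second argument.\<close>
    have "continuous_on UNIV (\<lambda>(x, y::complex). c * x)" "continuous_on UNIV (\<lambda>(x, y::complex). cnj x)"
      unfolding case_prod_unfold
      by - (intro continuous_on_mult_left continuous_on_cnj continuous_on_fst continuous_on_id)+
    from this[THEN continuous_glued_map2, OF g(1,2) g(1,2)]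
    show "c *\<^sub>C x \<in> diag_embed \<iota> ` ?S" "star x \<in> diag_embed \<iota> ` ?S"
      unfolding g(3) diag_embed_scale[OF g(1), symmetric] diag_embed_cnj[OF g(1), symmetric]
      by - (rule imageI, assumption)+
  qed
qed

end

section \<open>The centre and maximality\<close>

theorem proposition3p18:
  fixes \<iota> :: "nat \<Rightarrow> complex mat \<Rightarrow> 'u::cstar_algebra"
    and v :: "3 \<Rightarrow> real^2"
    and w :: "3 \<Rightarrow> real^2 \<Rightarrow> real^2"
    and K :: "(real^2) set"
  assumes "uhf_3_infinity \<iota>"
    and "equilateral_triangle v"
    and "gasket_maps v w"
    and "is_gasket w K"
  shows "centre_of (A_inf \<iota>) = range (\<lambda>c. c *\<^sub>C 1) \<and>
         maximal_abelian_subalgebra (C_gasket \<iota> w K) (A_inf \<iota>)"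
proof -
  interpret uhf_3_infinity \<iota> by fact
  interpret gasket v w K by unfold_locales fact+
  obtain g :: "(nat \<Rightarrow> 3) \<Rightarrow> complex" where uc: "continuous_on_words g" and glued: "glued g"
    and le: "\<And>\<sigma>. cmod (g \<sigma>) \<le> 1" and g13: "\<And>\<sigma>. \<sigma> 0 = 1 \<Longrightarrow> \<sigma> 1 = 3 \<Longrightarrow> g \<sigma> = 1"
    and zero: "\<And>j. g (vertex_word [j]) = 0"
    by (rule ex_bump) blast
  have g1: "g (prepend [1, 3] \<sigma>) = 1" for \<sigma> by (rule g13) (simp_all add: prepend_def)
  have mem: "E \<sigma> \<tau> * shifted g N \<in> A_inf \<iota>" if "length \<sigma> = N" "length \<tau> = N" for N \<sigma> \<tau>
    using E_mult_shifted_in_A_inf[OF uc glued that] zero by blast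
  have memC: "E \<sigma> \<sigma> * shifted g N \<in> C_gasket \<iota> w K" if "length \<sigma> = N" for N \<sigma>
    unfolding C_gasket_eq E_mult_shifted_eq_diag_embed(1)[OF uc that]
    by (intro imageI CollectI conjI E_mult_shifted_eq_diag_embed(2)[OF uc that]
        glued_cylinder_shift glued zero)
  have sub: "C_gasket \<iota> w K \<subseteq> A_inf \<iota>"
    unfolding C_gasket_eq using diag_embed_in_A_inf by blast
  have commutative: "commutative_set (C_gasket \<iota> w K)"
    unfolding C_gasket_eq commutative_set_def
    by (auto simp: mult.commute simp flip: diag_embed_mult)
  \<comment> \<open>The relative commutant of C(K) lies in C(K), which gives maximality: a
    commutative set containing C(K) commutes with it.\<close>
  have commutant: "a \<in> C_gasket \<iota> w K"
    if a: "a \<in> A_inf \<iota>" and comm: "\<And>x. x \<in> C_gasket \<iota> w K \<Longrightarrow> a * x = x * a" for a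
  proof -
    have "\<exists>n d. norm (a - D n d) < e" if "e > 0" for e
      using commuting_approximation[OF uc le g1 comm[OF memC] that] by blast
    then obtain h where h: "continuous_on_words h" "a = diag_embed \<iota> h"
      by (rule limit_of_diagonals)
    then show ?thesis
      using glued_if_in_A_inf[OF h(1)] a unfolding C_gasket_eq by blast
  qed
  have "centre_of (A_inf \<iota>) = range (\<lambda>c. c *\<^sub>C 1)"
  proof
    show "centre_of (A_inf \<iota>) \<subseteq> range (\<lambda>c. c *\<^sub>C 1)"
    proof
      fix z assume "z \<in> centre_of (A_inf \<iota>)"
      then have "z * (E \<sigma> \<tau> * shifted g N) = E \<sigma> \<tau> * shifted g N * z"
        if "length \<sigma> = N" "length \<tau> = N" for N \<sigma> \<tau>
        using mem[OF that] by (simp add: centre_of_def)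
      then show "z \<in> range (\<lambda>c. c *\<^sub>C 1)" by (rule central_is_scalar[OF uc le g1])
    qed
    have "c *\<^sub>C 1 \<in> A_inf \<iota>" for c
      using diag_embed_in_A_inf[of "\<lambda>_. c"]
      by (simp add: diag_embed_const continuous_on_words_def glued_def)
    then show "range (\<lambda>c. c *\<^sub>C 1) \<subseteq> centre_of (A_inf \<iota>)"
      by (auto simp: centre_of_def mult_scaleC_left mult_scaleC_right)
  qed
  moreover have "C = C_gasket \<iota> w K"
    if "commutative_set C" "C_gasket \<iota> w K \<subseteq> C" "C \<subseteq> A_inf \<iota>" for C
    using that commutant unfolding commutative_set_def by blast
  ultimately show ?thesis
    using cstar_subalgebra_C_gasket[OF assms(1)] commutative sub
    unfolding maximal_abelian_subalgebra_def by blast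
qed

end
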